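(* In the setting described in the context, there exists a unique Borel probability measure $\mu$ on $\overline{\mathbb{R}}$ satisfying $$\mu=\tfrac13\big((\tau_1)_*\mu+(\tau_2)_*\mu+(\tau_3)_*\mu\big),$$ where $(\tau_i)_*\mu$ is the pushforward under $\tau_i|_{\overline{\mathbb{R}}}\colon\overline{\mathbb{R}}\to\overline{\mathbb{R}}$.
   Context: Let $\mathbb{H}=\{z\in\mathbb{C}:\operatorname{Im}z>0\}$ be the Poincaré upper half-plane (metric $(dx^2+dy^2)/y^2$), $\overline{\mathbb{R}}=\mathbb{R}\cup\{\infty\}$, and $\overline{\mathbb{H}}=\mathbb{H}\cup\overline{\mathbb{R}}$ (a closed disk). A (hyperbolic) line is a set $\{z\in\mathbb{H}:\operatorname{Re}z=x\}$ or $\{z\in\mathbb{H}:|z-x|=r\}$ with $x\in\mathbb{R}$, $r>0$; its reflection $t_L$ is $t_L(z)=2x-\bar z$, resp. $t_L(z)=r^2/(\bar z-x)+x$, extended continuously to $\overline{\mathbb{H}}$. Fix lines $L_1,L_2,L_3\subseteq\mathbb{H}$ and $z_0\in\mathbb{H}$ such that for all distinct $i,i'\in\{1,2,3\}$ either (a) $L_i\cap L_{i'}=\emptyset$ and $z_0$ lies in the connected component of $\mathbb{H}\setminus(L_i\cup L_{i'})$ whose boundary contains both lines, or (b) $L_i,L_{i'}$ meet at an angle of measure $\pi/m(i,i')$ with $m(i,i')\ge2$ an integer, and $z_0$ lies in the interior of that angle. Let $s_i=t_{L_i}$. The one-way reflection $\tau_i\colon\overline{\mathbb{H}}\to\overline{\mathbb{H}}$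 is $\tau_i(z)=s_i(z)$ if $z$ and $z_0$ are on the same side of $L_i$ and $\tau_i(z)=z$ otherwise; it is continuous and maps $\overline{\mathbb{R}}$ to itself. *)

theory Defs
  imports "HOL-Probability.Probability"
begin

definition uhp :: "complex set" where
  "uhp = {z. Im z > 0}"

datatype hline = VLine real | CLine real real

fun hline_ok :: "hline \<Rightarrow> bool" where
  "hline_ok (VLine x) = True"
| "hline_ok (CLine x r) = (r > 0)"

fun hset :: "hline \<Rightarrow> complex set" where
  "hset (VLine x) = {z. Im z > 0 \<and> Re z = x}"
| "hset (CLine x r) = {z. Im z > 0 \<and> cmod (z - complex_of_real x) = r}"

section \<open>The extended real line (one-point compactification), None = infinity\<close>

type_synonym rbar = "real option"

definition rbar_open :: "rbar set \<Rightarrow> bool" where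
  "rbar_open U \<longleftrightarrow> open (Some -` U) \<and> (None \<in> U \<longrightarrow> compact (- (Some -` U)))"

definition rbar_borel :: "rbar measure" where
  "rbar_borel = sigma UNIV (Collect rbar_open)"

text \<open>Continuous extension of t_L to the boundary: vertical line x:
  z \<mapsto> 2x - conj z, infinity fixed; circle (x,r): z \<mapsto> r^2/(conj z - x) + x,
  with x \<mapsto> infinity and infinity \<mapsto> x.\<close>
fun refl_rbar :: "hline \<Rightarrow> rbar \<Rightarrow> rbar" where
  "refl_rbar (VLine x) (Some t) = Some (2 * x - t)"
| "refl_rbar (VLine x) None = None"
| "refl_rbar (CLine x r) (Some t) = (if t = x then None else Some (r\<^sup>2 / (t - x) + x))"
| "refl_rbar (CLine x r) None = Some x"

fun side :: "hline \<Rightarrow> complex \<Rightarrow> real" where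
  "side (VLine x) z = Re z - x"
| "side (CLine x r) z = cmod (z - complex_of_real x) - r"

fun side_rbar :: "hline \<Rightarrow> rbar \<Rightarrow> real" where
  "side_rbar L (Some t) = side L (complex_of_real t)"
| "side_rbar (VLine x) None = 0"   \<comment> \<open>infinity is an endpoint of a vertical line (fixed)\<close>
| "side_rbar (CLine x r) None = 1" \<comment> \<open>infinity lies outside every half-circle\<close>

definition tau :: "hline \<Rightarrow> complex \<Rightarrow> rbar \<Rightarrow> rbar" where
  "tau L z0 w = (if side_rbar L w * side L z0 > 0 then refl_rbar L w else w)"

definition disjoint_config :: "hline \<Rightarrow> hline \<Rightarrow> complex \<Rightarrow> bool" where
  "disjoint_config L L' z0 \<longleftrightarrow>
     hset L \<inter> hset L' = {} \<and>
     hset L \<union> hset L' \<subseteq>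
       frontier (connected_component_set (uhp - (hset L \<union> hset L')) z0)"

text \<open>The lines meet at a single point p at angle pi/m, and z0 lies in the interior of
  that angle: the component C of uhp minus the two lines that contains z0 is bounded
  near p by a ray R of L and a ray R' of L' (components of the line minus p), whose
  unit tangent directions a, b at p make the angle pi/m.\<close>
definition angle_config :: "hline \<Rightarrow> hline \<Rightarrow> complex \<Rightarrow> nat \<Rightarrow> bool" where
  "angle_config L L' z0 m \<longleftrightarrow>
     m \<ge> 2 \<and>
     (\<exists>p. hset L \<inter> hset L' = {p} \<and>
       (\<exists>R R' a b.
          R \<in> components (hset L - {p}) \<and> R' \<in> components (hset L' - {p}) \<and>
          R \<union> R' \<subseteq> frontier (connected_component_set (uhp - (hset L \<union> hset L')) z0) \<and>
          ((\<lambda>q. sgn (q - p)) \<longlongrightarrow> a) (at p within R) \<and>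
          ((\<lambda>q. sgn (q - p)) \<longlongrightarrow> b) (at p within R') \<and>
          arccos (Re (a * cnj b)) = pi / real m))"

definition admissible_pair :: "hline \<Rightarrow> hline \<Rightarrow> complex \<Rightarrow> bool" where
  "admissible_pair L L' z0 \<longleftrightarrow>
     disjoint_config L L' z0 \<or> (\<exists>m. angle_config L L' z0 m)"

end

theory Submission
  imports Defs
begin

text \<open>
  Send the extended real line to the unit circle by the Cayley transform centred at \<open>z0\<close>. Each
  one-way reflection is then a weak contraction of the chordal distance, and near a point strictly
  on the side of \<open>z0\<close> the contraction is strict. Represent a line by a quadratic form
  \<open>a |z|\<^sup>2 + b Re z + c\<close>, oriented to be positive at \<open>z0\<close>. The hypothesis on each pair of lines makes
  the Lorentzian product of the two forms nonpositive, and then no boundary point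
  lies on the far side of all three lines: otherwise, projecting orthogonally to the geodesic from
  that point through \<open>z0\<close> (a one-dimensional space), two of the three forms would point the same way
  and have positive product. By compactness the three maps contract on average by a factor
  \<open>c < 1\<close>. Such a system has a unique stationary law: backward iteration converges almost surely, and
  averages of Lipschitz functions become constant.
\<close>

text \<open>No single map contracts strictly: each \<open>tau\<close> fixes the far side of its
  line, and even on the near side the gain tends to 0 at the endpoints of the line. The way out is
  that \<open>dist_tau\<close> measures contraction at one point \<open>s\<close> alone, uniformly
  in \<open>t\<close>. Compactness is then needed only for single points, not for pairs of distinct
  points with their degeneration at the diagonal. If the gains at \<open>s\<close> sum to at least
  \<open>e > 0\<close>, one of the three is at least \<open>e / 3\<close>; that map contracts by
  \<open>k = 1 / sqrt (1 + e / 3)\<close>, the other two do not expand, and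
  \<open>c = (2 + k) / 3\<close>. The sign of the Lorentzian product for crossing lines comes from
  the angle: at the crossing point the product is the Euclidean product of the normals directed
  towards \<open>z0\<close>, and an interior angle of at most \<open>pi / 2\<close> keeps these at
  least \<open>pi / 2\<close> apart.\<close>

section \<open>Systems of maps contracting on average\<close>

text \<open>\<open>M\<close> carries only a sigma-algebra; the metric is pulled back along
  \<open>emb\<close>. The measurable left inverse \<open>ret\<close> turns limits of embedded points
  into states and brings equality of image measures back to \<open>M\<close>; closedness of the
  range keeps limits among the states.\<close>

locale average_contraction =
  fixes M :: "'s measure" and emb :: "'s \<Rightarrow> 'e::{banach, second_countable_topology}"
    and ret :: "'e \<Rightarrow> 's" and f :: "'i::countable \<Rightarrow> 's \<Rightarrow> 's" and I :: "'i set" and c :: real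
  assumes space_M: "space M = UNIV"
    and emb_measurable [measurable]: "emb \<in> borel_measurable M"
    and ret_measurable [measurable]: "ret \<in> measurable borel M"
    and ret_emb: "ret (emb x) = x"
    and closed_range_emb: "closed (range emb)"
    and bounded_range_emb: "bounded (range emb)"
    and f_measurable [measurable]: "f i \<in> measurable M M"
    and finite_I: "finite I" and I_nonempty: "I \<noteq> {}"
    and c_nonneg: "0 \<le> c" and c_less_1: "c < 1"
    and contraction:
      "(\<Sum>i\<in>I. dist (emb (f i x)) (emb (f i y))) \<le> c * real (card I) * dist (emb x) (emb y)"
begin

definition invariant :: "'s measure \<Rightarrow> bool" where
  "invariant \<mu> \<longleftrightarrow> sets \<mu> = sets M \<and> prob_space \<mu> \<and>
     (\<forall>A\<in>sets M. emeasure \<mu> A =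
        ennreal (1 / real (card I)) * (\<Sum>i\<in>I. emeasure (distr \<mu> M (f i)) A))"

lemma card_I_pos: "0 < card I"
  using finite_I I_nonempty by (simp add: card_gt_0_iff)

lemma nn_integral_uniform:
  "(\<integral>\<^sup>+i. g i \<partial>measure_pmf (pmf_of_set I)) = ennreal (1 / real (card I)) * (\<Sum>i\<in>I. g i)"
proof -
  have "ennreal (1 / real (card I)) = inverse (of_nat (card I))"
    using card_I_pos by (simp add: ennreal_of_nat_eq_real_of_nat inverse_ennreal inverse_eq_divide)
  then show ?thesis
    by (simp add: nn_integral_pmf_of_set[OF I_nonempty finite_I] divide_ennreal_def mult.commute)
qed

text \<open>A single map may expand, but its term is bounded by the whole nonnegative sum. This is
  the continuity used to pass to the limit under \<open>f i\<close>.\<close>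

lemma dist_f_le:
  assumes "i \<in> I"
  shows "dist (emb (f i x)) (emb (f i y)) \<le> c * real (card I) * dist (emb x) (emb y)"
  using member_le_sum[OF assms, of "\<lambda>i. dist (emb (f i x)) (emb (f i y))"] finite_I
    contraction[of x y] by auto

lemma emb_diam: obtains B where "B \<ge> 0" "\<And>x y. dist (emb x) (emb y) \<le> B"
proof -
  obtain B where B: "\<And>x. norm (emb x) \<le> B"
    using bounded_range_emb by (auto simp: bounded_iff)
  have "dist (emb x) (emb y) \<le> 2 * B" for x y
    using norm_triangle_ineq4[of "emb x" "emb y"] B[of x] B[of y] by (simp add: dist_norm)
  moreover have "2 * B \<ge> 0" using B[of undefined] norm_ge_zero[of "emb undefined"] by linarith
  ultimately show ?thesis using that by blast
qed

subsection \<open>Uniqueness\<close>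

text \<open>The transition operator of the chain, dual to the right-hand side of the stationarity
  equation.\<close>

definition avg :: "('s \<Rightarrow> real) \<Rightarrow> 's \<Rightarrow> real" where
  "avg g x = (\<Sum>i\<in>I. g (f i x)) / real (card I)"

lemma avg_measurable [measurable]:
  assumes [measurable]: "g \<in> borel_measurable M"
  shows "avg g \<in> borel_measurable M"
  unfolding avg_def by measurable

text \<open>Stationarity is given on sets. Writing \<open>\<mu>\<close> as the image of the product
  of the uniform law on \<open>I\<close> with \<open>\<mu>\<close> under evaluation transfers it to
  functions by change of variables and Tonelli.\<close>

lemma nn_integral_invariant:
  assumes "invariant \<mu>" and g [measurable]: "g \<in> borel_measurable M" and nn: "\<And>x. 0 \<le> g x"
  shows "(\<integral>\<^sup>+x. ennreal (avg g x) \<partial>\<mu>) = (\<integral>\<^sup>+x. ennreal (g x) \<partial>\<mu>)"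
proof -
  have sets [measurable_cong]: "sets \<mu> = sets M" and "prob_space \<mu>"
    and inv: "\<And>A. A \<in> sets M \<Longrightarrow> emeasure \<mu> A =
        ennreal (1 / real (card I)) * (\<Sum>i\<in>I. emeasure (distr \<mu> M (f i)) A)"
    using assms unfolding invariant_def by auto
  interpret prob_space \<mu> by fact
  define P where "P = measure_pmf (pmf_of_set I)"
  have [measurable_cong]: "sets P = sets (count_space UNIV)" unfolding P_def by simp
  interpret P: prob_space P unfolding P_def by (rule measure_pmf.prob_space_axioms)
  interpret PM: pair_sigma_finite P \<mu> by standard
  have F [measurable]: "(\<lambda>(i, x). f i x) \<in> measurable (P \<Otimes>\<^sub>M \<mu>) M"
    unfolding split_beta by (rule measurable_compose_countable[where g=fst]) measurable
  have eq: "\<mu> = distr (P \<Otimes>\<^sub>M \<mu>) M (\<lambda>(i, x). f i x)"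
  proof (rule measure_eqI)
    fix A assume "A \<in> sets \<mu>"
    then have A [measurable]: "A \<in> sets M" by (simp add: sets)
    have "emeasure (distr (P \<Otimes>\<^sub>M \<mu>) M (\<lambda>(i, x). f i x)) A
        = (\<integral>\<^sup>+y. indicator A y \<partial>distr (P \<Otimes>\<^sub>M \<mu>) M (\<lambda>(i, x). f i x))"
      by simp
    also have "\<dots> = (\<integral>\<^sup>+p. indicator A (case p of (i, x) \<Rightarrow> f i x) \<partial>(P \<Otimes>\<^sub>M \<mu>))"
      by (subst nn_integral_distr) auto
    also have "\<dots> = (\<integral>\<^sup>+i. \<integral>\<^sup>+x. indicator A (f i x) \<partial>\<mu> \<partial>P)"
      by (subst nn_integral_fst[symmetric]) auto
    also have "\<dots> = (\<integral>\<^sup>+i. emeasure (distr \<mu> M (f i)) A \<partial>P)"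
    proof (rule nn_integral_cong)
      fix i
      have "(\<integral>\<^sup>+x. indicator A (f i x) \<partial>\<mu>) = (\<integral>\<^sup>+x. indicator A x \<partial>distr \<mu> M (f i))"
        by (subst nn_integral_distr) auto
      then show "(\<integral>\<^sup>+x. indicator A (f i x) \<partial>\<mu>) = emeasure (distr \<mu> M (f i)) A" by simp
    qed
    also have "\<dots> = emeasure \<mu> A"
      unfolding P_def nn_integral_uniform inv[OF A] ..
    finally show "emeasure \<mu> A = emeasure (distr (P \<Otimes>\<^sub>M \<mu>) M (\<lambda>(i, x). f i x)) A" ..
  qed (simp add: sets)
  have "(\<integral>\<^sup>+x. ennreal (g x) \<partial>\<mu>)
      = (\<integral>\<^sup>+p. ennreal (g (case p of (i, x) \<Rightarrow> f i x)) \<partial>(P \<Otimes>\<^sub>M \<mu>))"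
    by (subst eq, subst nn_integral_distr) auto
  also have "\<dots> = (\<integral>\<^sup>+x. \<integral>\<^sup>+i. ennreal (g (f i x)) \<partial>P \<partial>\<mu>)"
    by (subst PM.nn_integral_snd[symmetric]) auto
  also have "\<dots> = (\<integral>\<^sup>+x. ennreal (avg g x) \<partial>\<mu>)"
  proof (rule nn_integral_cong)
    fix x
    show "(\<integral>\<^sup>+i. ennreal (g (f i x)) \<partial>P) = ennreal (avg g x)"
      unfolding P_def nn_integral_uniform avg_def
      by (simp add: nn ennreal_mult[symmetric] sum_nonneg)
  qed
  finally show ?thesis ..
qed

lemma avg_nonneg: "(\<And>x. 0 \<le> g x) \<Longrightarrow> 0 \<le> avg g x"
  unfolding avg_def by (intro divide_nonneg_nonneg sum_nonneg) auto

lemma avg_funpow: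
  assumes "g \<in> borel_measurable M" "\<And>x. 0 \<le> g x"
  shows "(avg ^^ n) g \<in> borel_measurable M \<and> (\<forall>x. 0 \<le> (avg ^^ n) g x)"
proof (induction n)
  case (Suc n)
  then show ?case by (auto intro!: avg_measurable avg_nonneg)
qed (use assms in simp)

lemma nn_integral_invariant_funpow:
  assumes "invariant \<mu>" "g \<in> borel_measurable M" "\<And>x. 0 \<le> g x"
  shows "(\<integral>\<^sup>+x. ennreal ((avg ^^ n) g x) \<partial>\<mu>) = (\<integral>\<^sup>+x. ennreal (g x) \<partial>\<mu>)"
proof (induction n)
  case (Suc n)
  then show ?case
    using nn_integral_invariant[OF assms(1), of "(avg ^^ n) g"] avg_funpow[OF assms(2,3), of n]
    by simp
qed simp

text \<open>Each application of \<open>avg\<close> multiplies the Lipschitz constant by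
  \<open>c\<close>: the triangle inequality leaves exactly the sum bounded by
  \<open>contraction\<close>.\<close>

lemma avg_funpow_lipschitz:
  assumes g: "\<And>x y. \<bar>g x - g y\<bar> \<le> K * dist (emb x) (emb y)" and "0 \<le> K"
  shows "\<bar>(avg ^^ n) g x - (avg ^^ n) g y\<bar> \<le> K * c ^ n * dist (emb x) (emb y)"
proof (induction n arbitrary: x y)
  case (Suc n)
  let ?h = "(avg ^^ n) g"
  have "\<bar>(\<Sum>i\<in>I. ?h (f i x)) - (\<Sum>i\<in>I. ?h (f i y))\<bar>
      \<le> (\<Sum>i\<in>I. \<bar>?h (f i x) - ?h (f i y)\<bar>)"
    by (simp add: sum_subtractf[symmetric])
  also have "\<dots> \<le> (\<Sum>i\<in>I. K * c ^ n * dist (emb (f i x)) (emb (f i y)))"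
    by (intro sum_mono Suc)
  also have "\<dots> = K * c ^ n * (\<Sum>i\<in>I. dist (emb (f i x)) (emb (f i y)))"
    by (simp add: sum_distrib_left)
  also have "\<dots> \<le> K * c ^ n * (c * real (card I) * dist (emb x) (emb y))"
    using contraction c_nonneg \<open>0 \<le> K\<close> by (intro mult_left_mono) auto
  finally have "\<bar>(\<Sum>i\<in>I. ?h (f i x)) - (\<Sum>i\<in>I. ?h (f i y))\<bar>
      \<le> K * c ^ Suc n * dist (emb x) (emb y) * real (card I)" by (simp add: algebra_simps)
  then have "\<bar>(\<Sum>i\<in>I. ?h (f i x)) - (\<Sum>i\<in>I. ?h (f i y))\<bar> / real (card I)
      \<le> K * c ^ Suc n * dist (emb x) (emb y)"
    using card_I_pos by (simp add: pos_divide_le_eq)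
  moreover have "\<bar>(avg ^^ Suc n) g x - (avg ^^ Suc n) g y\<bar> =
      \<bar>(\<Sum>i\<in>I. ?h (f i x)) - (\<Sum>i\<in>I. ?h (f i y))\<bar> / real (card I)"
    by (simp add: avg_def[of "(avg ^^ n) g"] diff_divide_distrib[symmetric])
  ultimately show ?case by simp
qed (use g in auto)

text \<open>Iterating \<open>avg\<close> preserves both integrals while the oscillation of the
  function decays like \<open>e n\<close>. An inequality suffices, since \<open>\<mu>\<close> and
  \<open>\<nu>\<close> can be exchanged.\<close>

lemma nn_integral_invariant_le:
  assumes \<mu>: "invariant \<mu>" and \<nu>: "invariant \<nu>"
    and g: "g \<in> borel_measurable M" and nn: "\<And>x. 0 \<le> g x"
    and lip: "\<And>x y. \<bar>g x - g y\<bar> \<le> K * dist (emb x) (emb y)" and "0 \<le> K"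
  shows "(\<integral>\<^sup>+x. ennreal (g x) \<partial>\<mu>) \<le> (\<integral>\<^sup>+x. ennreal (g x) \<partial>\<nu>)"
proof -
  interpret \<mu>: prob_space \<mu> using \<mu> by (simp add: invariant_def)
  interpret \<nu>: prob_space \<nu> using \<nu> by (simp add: invariant_def)
  have [measurable_cong]: "sets \<nu> = sets M" using \<nu> by (simp add: invariant_def)
  obtain B where B: "B \<ge> 0" "\<And>x y. dist (emb x) (emb y) \<le> B" using emb_diam by blast
  define e where "e n = K * c ^ n * B" for n
  have e0: "e n \<ge> 0" for n using \<open>0 \<le> K\<close> c_nonneg B(1) by (simp add: e_def)
  have osc: "\<bar>(avg ^^ n) g x - (avg ^^ n) g y\<bar> \<le> e n" for n x y
    using avg_funpow_lipschitz[OF lip \<open>0 \<le> K\<close>, of n x y]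
      mult_left_mono[OF B(2)[of x y], of "K * c ^ n"] \<open>0 \<le> K\<close> c_nonneg
    by (auto simp: e_def)
  \<comment> \<open>One \<open>e n\<close> pays for replacing the iterate by its value at a fixed
    point under \<open>\<mu>\<close>, the other for the way back under \<open>\<nu>\<close>.\<close>
  have step: "(\<integral>\<^sup>+x. ennreal (g x) \<partial>\<mu>) \<le> (\<integral>\<^sup>+x. ennreal (g x) \<partial>\<nu>) + ennreal (2 * e n)" for n
  proof -
    let ?h = "(avg ^^ n) g" and ?x = undefined
    have [measurable]: "?h \<in> borel_measurable M" and h0: "\<And>x. 0 \<le> ?h x"
      using avg_funpow[OF g nn] by auto
    have "(\<integral>\<^sup>+x. ennreal (?h x) \<partial>\<mu>) \<le> (\<integral>\<^sup>+x. ennreal (?h ?x + e n) \<partial>\<mu>)"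
    proof (intro nn_integral_mono ennreal_leI)
      fix x show "?h x \<le> ?h ?x + e n" using osc[of n x ?x] by linarith
    qed
    also have "\<dots> = ennreal (?h ?x + e n)" using \<mu>.emeasure_space_1 by simp
    also have "\<dots> = (\<integral>\<^sup>+x. ennreal (?h ?x + e n) \<partial>\<nu>)" using \<nu>.emeasure_space_1 by simp
    also have "\<dots> \<le> (\<integral>\<^sup>+x. ennreal (?h x) + ennreal (2 * e n) \<partial>\<nu>)"
    proof (intro nn_integral_mono)
      fix x
      have "?h ?x + e n \<le> ?h x + 2 * e n" using osc[of n x ?x] by linarith
      then show "ennreal (?h ?x + e n) \<le> ennreal (?h x) + ennreal (2 * e n)"
        using h0[of x] e0[of n] by (simp add: ennreal_plus[symmetric] ennreal_leI del: ennreal_plus)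
    qed
    also have "\<dots> = (\<integral>\<^sup>+x. ennreal (?h x) \<partial>\<nu>) + ennreal (2 * e n)"
      using \<nu>.emeasure_space_1 by (subst nn_integral_add) auto
    finally show ?thesis
      using nn_integral_invariant_funpow[OF \<mu> g nn] nn_integral_invariant_funpow[OF \<nu> g nn] by simp
  qed
  have "(\<lambda>n. 2 * (K * c ^ n * B)) \<longlonglongrightarrow> 2 * (K * 0 * B)"
    by (intro tendsto_intros LIMSEQ_realpow_zero c_nonneg c_less_1)
  then have "(\<lambda>n. ennreal (2 * e n)) \<longlonglongrightarrow> ennreal 0"
    unfolding e_def by (intro tendsto_ennrealI) simp
  then have "(\<lambda>n. (\<integral>\<^sup>+x. ennreal (g x) \<partial>\<nu>) + ennreal (2 * e n)) \<longlonglongrightarrow> (\<integral>\<^sup>+x. ennreal (g x) \<partial>\<nu>) + ennreal 0"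
    by (intro tendsto_add tendsto_const)
  then show ?thesis
    using step by (intro LIMSEQ_le_const) auto
qed

text \<open>Lipschitz cut-offs built from the distance to the complement converge to the indicator
  of an open set. The whole space is excluded because \<open>infdist\<close> to the empty set is 0,
  which would make the cut-offs vanish.\<close>

lemma emeasure_invariant_open:
  assumes \<mu>: "invariant \<mu>" and \<nu>: "invariant \<nu>" and "open U" "U \<noteq> UNIV"
  shows "emeasure \<mu> (emb -` U) \<le> emeasure \<nu> (emb -` U)"
proof -
  have sets [measurable_cong]: "sets \<mu> = sets M" "sets \<nu> = sets M"
    using \<mu> \<nu> by (simp_all add: invariant_def)
  interpret \<mu>: prob_space \<mu> using \<mu> by (simp add: invariant_def)
  interpret \<nu>: prob_space \<nu> using \<nu> by (simp add: invariant_def)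
  define g where "g n x = min 1 (real n * infdist (emb x) (- U))" for n x
  have [measurable]: "(\<lambda>x. infdist (emb x) (- U)) \<in> borel_measurable M"
    by (intro measurable_compose[OF emb_measurable] borel_measurable_continuous_onI
        continuous_on_infdist continuous_on_id)
  have gm [measurable]: "g n \<in> borel_measurable M" for n
    unfolding g_def by measurable
  have g0: "0 \<le> g n x" for n x by (simp add: g_def infdist_nonneg)
  have lip: "\<bar>g n x - g n y\<bar> \<le> real n * dist (emb x) (emb y)" for n x y
  proof -
    have "\<bar>g n x - g n y\<bar> \<le> \<bar>real n * infdist (emb x) (- U) - real n * infdist (emb y) (- U)\<bar>"
      unfolding g_def by linarith
    also have "\<dots> = real n * \<bar>infdist (emb x) (- U) - infdist (emb y) (- U)\<bar>"
      by (simp add: right_diff_distrib[symmetric] abs_mult)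
    also have "\<dots> \<le> real n * dist (emb x) (emb y)"
      by (intro mult_left_mono infdist_triangle_abs) simp
    finally show ?thesis .
  qed
  have lim: "(\<lambda>n. ennreal (g n x)) \<longlonglongrightarrow> indicator (emb -` U) x" for x
  proof (cases "emb x \<in> U")
    case True
    then have "infdist (emb x) (- U) > 0"
      using \<open>open U\<close> \<open>U \<noteq> UNIV\<close> in_closed_iff_infdist_zero[of "-U" "emb x"] infdist_nonneg[of "emb x" "-U"]
      by (auto simp: closed_def less_le)
    then obtain n0 where "1 < real n0 * infdist (emb x) (- U)" using reals_Archimedean3 by blast
    then have "g n x = 1" if "n \<ge> n0" for n
      using that mult_right_mono[of "real n0" "real n" "infdist (emb x) (- U)"]
        infdist_nonneg[of "emb x" "-U"] by (auto simp: g_def)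
    then have "eventually (\<lambda>n. ennreal (g n x) = 1) sequentially"
      by (auto simp: eventually_sequentially)
    then show ?thesis using True by (simp add: tendsto_eventually)
  next
    case False
    then have "infdist (emb x) (- U) = 0" by simp
    then show ?thesis using False by (simp add: g_def)
  qed
  have conv: "(\<lambda>n. \<integral>\<^sup>+x. ennreal (g n x) \<partial>m) \<longlonglongrightarrow> emeasure m (emb -` U)"
    if "prob_space m" and s [measurable_cong]: "sets m = sets M" for m
  proof -
    interpret prob_space m by fact
    have Um: "emb -` U \<in> sets m"
      using measurable_sets[OF emb_measurable, of U] \<open>open U\<close> space_M s by auto
    have "(\<lambda>n. \<integral>\<^sup>+x. ennreal (g n x) \<partial>m) \<longlonglongrightarrow> (\<integral>\<^sup>+x. indicator (emb -` U) x \<partial>m)"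
    proof (rule nn_integral_dominated_convergence[where w="\<lambda>_. 1"])
      show "(\<lambda>x. indicator (emb -` U) x) \<in> borel_measurable m" using Um by simp
      show "(\<integral>\<^sup>+x. 1 \<partial>m) < \<infinity>" using emeasure_space_1 by simp
      show "AE x in m. ennreal (g n x) \<le> 1" for n by (simp add: g_def)
      show "AE x in m. (\<lambda>n. ennreal (g n x)) \<longlonglongrightarrow> indicator (emb -` U) x"
        by (rule AE_I2) (rule lim)
    qed auto
    then show ?thesis using Um by simp
  qed
  show ?thesis
    using conv[OF \<mu>.prob_space_axioms sets(1)] conv[OF \<nu>.prob_space_axioms sets(2)]
      nn_integral_invariant_le[OF \<mu> \<nu> gm g0 lip]
    by (intro LIMSEQ_le[of "\<lambda>n. \<integral>\<^sup>+x. ennreal (g n x) \<partial>\<mu>" _ "\<lambda>n. \<integral>\<^sup>+x. ennreal (g n x) \<partial>\<nu>"]) auto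
qed

lemma invariant_unique:
  assumes \<mu>: "invariant \<mu>" and \<nu>: "invariant \<nu>"
  shows "\<mu> = \<nu>"
proof -
  have sets: "sets \<mu> = sets M" "sets \<nu> = sets M"
    using \<mu> \<nu> by (simp_all add: invariant_def)
  have space: "space \<mu> = UNIV" "space \<nu> = UNIV"
    using sets_eq_imp_space_eq[OF sets(1)] sets_eq_imp_space_eq[OF sets(2)] space_M by auto
  interpret \<mu>: prob_space \<mu> using \<mu> by (simp add: invariant_def)
  interpret \<nu>: prob_space \<nu> using \<nu> by (simp add: invariant_def)
  have em: "emb \<in> borel_measurable \<mu>" "emb \<in> borel_measurable \<nu>"
    using emb_measurable measurable_cong_sets[OF sets(1) refl] measurable_cong_sets[OF sets(2) refl]
    by blast+
  have "distr \<mu> borel emb = distr \<nu> borel emb"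
  proof (rule measure_eqI_generator_eq[where E="Collect open" and \<Omega>=UNIV and A="\<lambda>_. UNIV"])
    show "emeasure (distr \<mu> borel emb) U = emeasure (distr \<nu> borel emb) U"
      if "U \<in> Collect open" for U
    proof (cases "U = UNIV")
      case True
      then show ?thesis
        using em space \<mu>.emeasure_space_1 \<nu>.emeasure_space_1 by (simp add: emeasure_distr)
    next
      case False
      then show ?thesis
        using em space that emeasure_invariant_open[OF \<mu> \<nu>] emeasure_invariant_open[OF \<nu> \<mu>]
        by (auto simp: emeasure_distr intro!: antisym)
    qed
    show "emeasure (distr \<mu> borel emb) UNIV \<noteq> \<infinity>" 
      using em space by (simp add: emeasure_distr)
  qed (auto simp: Int_stable_def borel_def)
  then have "distr (distr \<mu> borel emb) M ret = distr (distr \<nu> borel emb) M ret" by simp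
  then have "distr \<mu> M (\<lambda>x. x) = distr \<nu> M (\<lambda>x. x)"
    using em by (simp add: distr_distr comp_def ret_emb)
  then show ?thesis
    using distr_id2[OF sets(1)[symmetric]] distr_id2[OF sets(2)[symmetric]] by simp
qed

subsection \<open>Existence\<close>

text \<open>
  The random maps are composed with the newest one innermost: this backward iteration converges
  pointwise, whereas the forward iteration converges only in law.
\<close>

primrec backward :: "nat \<Rightarrow> 'i stream \<Rightarrow> 's" where
  "backward 0 \<omega> = undefined"
| "backward (Suc n) \<omega> = f (shd \<omega>) (backward n (stl \<omega>))"

text \<open>Where the orbit diverges the value is unspecified; the function is still measurable, and
  divergence has probability 0.\<close>

definition backward_limit :: "'i stream \<Rightarrow> 's" where
  "backward_limit \<omega> = ret (lim (\<lambda>n. emb (backward n \<omega>)))"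

abbreviation iid :: "'i stream measure" where
  "iid \<equiv> stream_space (measure_pmf (pmf_of_set I))"

lemma backward_measurable [measurable]: "backward n \<in> measurable iid M"
proof (induction n)
  case 0
  then show ?case using space_M by (simp add: measurable_const)
next
  case (Suc n)
  note [measurable] = Suc
  have "(\<lambda>\<omega>. f (shd \<omega>) (backward n (stl \<omega>))) \<in> measurable iid M"
    by (rule measurable_compose_countable[where g=shd]) measurable
  then show ?case by simp
qed

lemma backward_limit_measurable [measurable]: "backward_limit \<in> measurable iid M"
  unfolding backward_limit_def by measurable

lemma nn_integral_iid:
  assumes g: "g \<in> borel_measurable iid"
  shows "(\<integral>\<^sup>+\<omega>. g \<omega> \<partial>iid)
    = ennreal (1 / real (card I)) * (\<Sum>i\<in>I. \<integral>\<^sup>+\<omega>. g (i ## \<omega>) \<partial>iid)"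
  using prob_space.nn_integral_stream_space[OF measure_pmf.prob_space_axioms g]
  by (simp add: nn_integral_uniform)

text \<open>The orbits of length \<open>n\<close> and \<open>Suc n\<close> along one stream share
  their outer maps. Splitting off the head, which is uniform and independent of the tail, gains a
  factor \<open>c\<close> per induction step.\<close>

lemma nn_integral_backward_dist:
  assumes B: "\<And>x y. dist (emb x) (emb y) \<le> B"
  shows "(\<integral>\<^sup>+\<omega>. ennreal (dist (emb (backward n \<omega>)) (emb (backward (Suc n) \<omega>))) \<partial>iid)
    \<le> ennreal (B * c ^ n)"
proof (induction n)
  case 0
  interpret prob_space iid by (rule prob_space.prob_space_stream_space[OF measure_pmf.prob_space_axioms])
  have "(\<integral>\<^sup>+\<omega>. ennreal (dist (emb (backward 0 \<omega>)) (emb (backward (Suc 0) \<omega>))) \<partial>iid)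
    \<le> (\<integral>\<^sup>+\<omega>. ennreal B \<partial>iid)"
    by (intro nn_integral_mono ennreal_leI B)
  then show ?case using emeasure_space_1 by simp
next
  case (Suc n)
  let ?d = "\<lambda>\<omega>. dist (emb (backward n \<omega>)) (emb (backward (Suc n) \<omega>))"
  have m [measurable]: "f i \<in> measurable M M" for i by (rule f_measurable)
  have "(\<integral>\<^sup>+\<omega>. ennreal (dist (emb (backward (Suc n) \<omega>)) (emb (backward (Suc (Suc n)) \<omega>))) \<partial>iid)
    = ennreal (1 / real (card I)) * (\<Sum>i\<in>I. \<integral>\<^sup>+\<omega>.
        ennreal (dist (emb (f i (backward n \<omega>))) (emb (f i (backward (Suc n) \<omega>)))) \<partial>iid)"
  proof (subst nn_integral_iid)
    show "(\<lambda>\<omega>. ennreal (dist (emb (backward (Suc n) \<omega>)) (emb (backward (Suc (Suc n)) \<omega>))))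
      \<in> borel_measurable iid"
      using backward_measurable[of "Suc n"] backward_measurable[of "Suc (Suc n)"] by measurable
  qed simp
  also have "\<dots> = ennreal (1 / real (card I)) * (\<integral>\<^sup>+\<omega>. (\<Sum>i\<in>I.
        ennreal (dist (emb (f i (backward n \<omega>))) (emb (f i (backward (Suc n) \<omega>))))) \<partial>iid)"
    using backward_measurable[of "Suc n"] by (subst nn_integral_sum) measurable
  also have "\<dots> \<le> ennreal (1 / real (card I)) * (\<integral>\<^sup>+\<omega>. ennreal (c * real (card I) * ?d \<omega>) \<partial>iid)"
    by (intro mult_left_mono nn_integral_mono) (auto intro!: ennreal_leI contraction)
  also have "\<dots> = ennreal (1 / real (card I)) * (ennreal (c * real (card I)) * (\<integral>\<^sup>+\<omega>. ennreal (?d \<omega>) \<partial>iid))"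
    using c_nonneg backward_measurable[of "Suc n"]
    by (subst nn_integral_cmult[symmetric]) (auto simp: ennreal_mult)
  also have "\<dots> = ennreal c * (\<integral>\<^sup>+\<omega>. ennreal (?d \<omega>) \<partial>iid)"
    using c_nonneg card_I_pos by (simp add: mult.assoc[symmetric] ennreal_mult[symmetric])
  also have "\<dots> \<le> ennreal c * ennreal (B * c ^ n)"
    by (intro mult_left_mono Suc) simp
  also have "\<dots> = ennreal (B * c ^ Suc n)"
    using c_nonneg by (simp add: ennreal_mult'[symmetric] mult.left_commute)
  finally show ?case .
qed

text \<open>The expected total length of the orbit is bounded by a geometric series, so almost every
  orbit has finite length and converges in the Banach space.\<close>

lemma AE_backward_convergent: "AE \<omega> in iid. convergent (\<lambda>n. emb (backward n \<omega>))"
proof -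
  obtain B where B: "B \<ge> 0" "\<And>x y. dist (emb x) (emb y) \<le> B" using emb_diam by blast
  let ?d = "\<lambda>n \<omega>. dist (emb (backward n \<omega>)) (emb (backward (Suc n) \<omega>))"
  have dm [measurable]: "?d n \<in> borel_measurable iid" for n
    using backward_measurable[of n] backward_measurable[of "Suc n"] by measurable
  have "(\<integral>\<^sup>+\<omega>. (\<Sum>n. ennreal (?d n \<omega>)) \<partial>iid) = (\<Sum>n. \<integral>\<^sup>+\<omega>. ennreal (?d n \<omega>) \<partial>iid)"
    by (intro nn_integral_suminf measurable_compose[OF dm] measurable_ennreal)
  also have "\<dots> \<le> (\<Sum>n. ennreal (B * c ^ n))"
    by (intro suminf_le nn_integral_backward_dist[OF B(2)]) auto
  also have "\<dots> < \<infinity>"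
    using c_nonneg c_less_1 B(1)
    by (subst suminf_ennreal2) (auto intro!: summable_mult summable_geometric)
  finally have "AE \<omega> in iid. (\<Sum>n. ennreal (?d n \<omega>)) \<noteq> \<infinity>"
    by (intro nn_integral_PInf_AE borel_measurable_suminf_order measurable_compose[OF dm] measurable_ennreal) auto
  then show ?thesis
  proof eventually_elim
    case (elim \<omega>)
    then have "summable (\<lambda>n. ?d n \<omega>)"
      by (intro summable_suminf_not_top) auto
    then have "summable (\<lambda>n. norm (emb (backward (Suc n) \<omega>) - emb (backward n \<omega>)))"
      by (simp add: dist_norm norm_minus_commute)
    then have "summable (\<lambda>n. emb (backward (Suc n) \<omega>) - emb (backward n \<omega>))"
      by (rule summable_norm_cancel)
    then have "convergent (\<lambda>n. \<Sum>k<n. emb (backward (Suc k) \<omega>) - emb (backward k \<omega>))"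
      by (simp add: summable_iff_convergent)
    then have "convergent (\<lambda>n. emb (backward n \<omega>) - emb (backward 0 \<omega>))"
      by (simp only: sum_lessThan_telescope[of "\<lambda>k. emb (backward k \<omega>)"])
    then show ?case
      using convergent_add[OF _ convergent_const[of "emb (backward 0 \<omega>)"]] by fastforce
  qed
qed

text \<open>Prepending \<open>i\<close> applies \<open>f i\<close> outermost, hence to the limit, by
  continuity. The null set concerns tails \<open>\<omega>\<close> and is common to all
  \<open>i\<close>, which suits the splitting in \<open>nn_integral_iid\<close>.\<close>

lemma AE_backward_limit_Stream:
  "AE \<omega> in iid. \<forall>i\<in>I. backward_limit (i ## \<omega>) = f i (backward_limit \<omega>)"
  using AE_backward_convergent
proof eventually_elim
  case (elim \<omega>)
  then obtain l where l: "(\<lambda>n. emb (backward n \<omega>)) \<longlonglongrightarrow> l" by (auto simp: convergent_def)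
  then have "l \<in> range emb"
    by (rule closed_sequentially[OF closed_range_emb, rotated]) auto
  then obtain x where x: "l = emb x" by auto
  have limit: "backward_limit \<omega> = x"
    using limI[OF l] by (simp add: backward_limit_def x ret_emb)
  show ?case
  proof
    fix i assume "i \<in> I"
    have "(\<lambda>n. dist (emb (backward n \<omega>)) (emb x)) \<longlonglongrightarrow> 0"
      using l[unfolded x] by (rule tendsto_dist_iff[THEN iffD1])
    then have "(\<lambda>n. c * real (card I) * dist (emb (backward n \<omega>)) (emb x)) \<longlonglongrightarrow> 0"
      by (rule tendsto_mult_right_zero)
    then have "(\<lambda>n. dist (emb (f i (backward n \<omega>))) (emb (f i x))) \<longlonglongrightarrow> 0"
      by (rule tendsto_sandwich[OF _ _ tendsto_const, rotated 2])
        (intro always_eventually allI zero_le_dist dist_f_le \<open>i \<in> I\<close>)+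
    then have "(\<lambda>n. emb (backward (Suc n) (i ## \<omega>))) \<longlonglongrightarrow> emb (f i x)"
      by (simp add: tendsto_dist_iff[of _ "emb (f i x)", symmetric])
    then have "(\<lambda>n. emb (backward n (i ## \<omega>))) \<longlonglongrightarrow> emb (f i x)"
      by (rule LIMSEQ_imp_Suc)
    then have "lim (\<lambda>n. emb (backward n (i ## \<omega>))) = emb (f i x)"
      by (rule limI)
    then show "backward_limit (i ## \<omega>) = f i (backward_limit \<omega>)"
      by (simp add: backward_limit_def[of "i ## \<omega>"] ret_emb limit)
  qed
qed

text \<open>A stream is a uniform head followed by an independent tail of the same law, so the
  almost sure equation for the limit becomes a fixed point equation for its law.\<close>

lemma invariant_backward_limit: "invariant (distr iid M backward_limit)"
  unfolding invariant_def
proof (intro conjI ballI)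
  interpret prob_space iid by (rule prob_space.prob_space_stream_space[OF measure_pmf.prob_space_axioms])
  show "prob_space (distr iid M backward_limit)" by (rule prob_space_distr) measurable
  fix A assume A [measurable]: "A \<in> sets M"
  have "emeasure (distr iid M backward_limit) A = (\<integral>\<^sup>+x. indicator A x \<partial>distr iid M backward_limit)"
    by simp
  also have "\<dots> = (\<integral>\<^sup>+\<omega>. indicator A (backward_limit \<omega>) \<partial>iid)"
    by (subst nn_integral_distr) auto
  also have "\<dots> = ennreal (1 / real (card I)) *
      (\<Sum>i\<in>I. \<integral>\<^sup>+\<omega>. indicator A (backward_limit (i ## \<omega>)) \<partial>iid)"
    by (subst nn_integral_iid) auto
  also have "(\<Sum>i\<in>I. \<integral>\<^sup>+\<omega>. indicator A (backward_limit (i ## \<omega>)) \<partial>iid)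
      = (\<Sum>i\<in>I. emeasure (distr (distr iid M backward_limit) M (f i)) A)"
  proof (rule sum.cong[OF refl])
    fix i assume "i \<in> I"
    have "AE \<omega> in iid. backward_limit (i ## \<omega>) = f i (backward_limit \<omega>)"
      using AE_backward_limit_Stream by eventually_elim (use \<open>i \<in> I\<close> in auto)
    then have "(\<integral>\<^sup>+\<omega>. indicator A (backward_limit (i ## \<omega>)) \<partial>iid)
        = (\<integral>\<^sup>+\<omega>. indicator A (f i (backward_limit \<omega>)) \<partial>iid)"
      by (intro nn_integral_cong_AE) (auto elim!: eventually_mono)
    also have "\<dots> = (\<integral>\<^sup>+x. indicator A x \<partial>distr (distr iid M backward_limit) M (f i))"
      by (subst nn_integral_distr, simp, simp, subst nn_integral_distr) auto
    finally show "(\<integral>\<^sup>+\<omega>. indicator A (backward_limit (i ## \<omega>)) \<partial>iid)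
        = emeasure (distr (distr iid M backward_limit) M (f i)) A" by simp
  qed
  finally show "emeasure (distr iid M backward_limit) A = ennreal (1 / real (card I)) *
      (\<Sum>i\<in>I. emeasure (distr (distr iid M backward_limit) M (f i)) A)" .
qed simp

theorem ex1_invariant: "\<exists>!\<mu>. invariant \<mu>"
  using invariant_backward_limit invariant_unique by blast

end

section \<open>Quadratic forms and the chordal contraction\<close>

fun coef_a :: "hline \<Rightarrow> real" where
  "coef_a (VLine x) = 0" | "coef_a (CLine x r) = 1"

fun coef_b :: "hline \<Rightarrow> real" where
  "coef_b (VLine x) = 1" | "coef_b (CLine x r) = - 2 * x"

fun coef_c :: "hline \<Rightarrow> real" where
  "coef_c (VLine x) = - x" | "coef_c (CLine x r) = x\<^sup>2 - r\<^sup>2"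

definition quad :: "hline \<Rightarrow> complex \<Rightarrow> real" where
  "quad L z = coef_a L * (cmod z)\<^sup>2 + coef_b L * Re z + coef_c L"

text \<open>The Lorentzian norm of the form: 1 for a vertical line, \<open>4 * r\<^sup>2\<close> for
  a circle. Up to sign it is the determinant of the matrix in \<open>refl_rbar_hom\<close>.\<close>

definition disc :: "hline \<Rightarrow> real" where
  "disc L = (coef_b L)\<^sup>2 - 4 * coef_a L * coef_c L"

text \<open>
  \<open>hom_u w : hom_v w\<close> are homogeneous coordinates of \<open>w\<close>; they make infinity an ordinary point in
  the identities for \<open>bquad\<close>, \<open>visual\<close> and \<open>wedge\<close>.
\<close>

fun hom_u :: "rbar \<Rightarrow> real" where
  "hom_u (Some t) = t" | "hom_u None = 1"

fun hom_v :: "rbar \<Rightarrow> real" where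
  "hom_v (Some t) = 1" | "hom_v None = 0"

definition bquad :: "hline \<Rightarrow> rbar \<Rightarrow> real" where
  "bquad L w = coef_a L * (hom_u w)\<^sup>2 + coef_b L * hom_u w * hom_v w + coef_c L * (hom_v w)\<^sup>2"

text \<open>This is |u - v * z0|^2 in homogeneous coordinates u : v; at finite points its reciprocal
  is, up to a constant, the Poisson kernel at \<open>z0\<close>.\<close>

definition visual :: "complex \<Rightarrow> rbar \<Rightarrow> real" where
  "visual z0 w = (hom_u w - hom_v w * Re z0)\<^sup>2 + (hom_v w * Im z0)\<^sup>2"

definition wedge :: "rbar \<Rightarrow> rbar \<Rightarrow> real" where
  "wedge s t = hom_u s * hom_v t - hom_u t * hom_v s"

definition cayley :: "complex \<Rightarrow> rbar \<Rightarrow> complex" where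
  "cayley z0 w = (of_real (hom_u w) - of_real (hom_v w) * z0) /
     (of_real (hom_u w) - of_real (hom_v w) * cnj z0)"

lemma disc_pos: "hline_ok L \<Longrightarrow> disc L > 0"
  by (cases L) (auto simp: disc_def power2_eq_square algebra_simps)

text \<open>For a circle the form is |z - x|^2 - r^2, which is \<open>side\<close> times the
  positive factor |z - x| + r.\<close>

lemma sgn_side:
  assumes "hline_ok L"
  shows "sgn (side L z) = sgn (quad L z)"
proof (cases L)
  case (CLine x r)
  then have r: "r > 0" using assms by simp
  have "quad L z = (cmod (z - of_real x))\<^sup>2 - r\<^sup>2"
    unfolding CLine quad_def cmod_power2 by (simp add: power2_eq_square algebra_simps)
  also have "\<dots> = side L z * (cmod (z - of_real x) + r)"
    unfolding CLine by (simp add: power2_eq_square algebra_simps)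
  finally have "quad L z = side L z * (cmod (z - of_real x) + r)" .
  moreover have "cmod (z - of_real x) + r > 0" using r norm_ge_zero[of "z - of_real x"] by linarith
  ultimately show ?thesis by (simp add: sgn_mult)
qed (simp add: quad_def)

lemma sgn_side_rbar:
  assumes "hline_ok L"
  shows "sgn (side_rbar L w) = sgn (bquad L w)"
proof (cases w)
  case None
  then show ?thesis by (cases L) (auto simp: bquad_def)
next
  case (Some t)
  have "quad L (of_real t) = bquad L w"
    unfolding Some quad_def bquad_def cmod_power2 by simp
  then show ?thesis using sgn_side[OF assms, of "of_real t"] Some by simp
qed

lemma tau_eq:
  assumes "hline_ok L"
  shows "tau L z0 w = (if bquad L w * quad L z0 > 0 then refl_rbar L w else w)"
proof -
  have "sgn (side_rbar L w * side L z0) = sgn (bquad L w * quad L z0)"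
    using sgn_side[OF assms] sgn_side_rbar[OF assms] by (simp add: sgn_mult)
  then show ?thesis
    unfolding tau_def by (metis sgn_1_pos)
qed

text \<open>On the boundary the reflection is the Moebius map with rows (b, 2c), (-2a, -b), whose
  fixed points are the zeros of the form. The scalar \<open>k\<close> is read off the coordinate of
  the image that must equal 1.\<close>

lemma refl_rbar_hom:
  assumes "hline_ok L"
  obtains k where "k \<noteq> 0"
    "hom_u (refl_rbar L w) = k * (coef_b L * hom_u w + 2 * coef_c L * hom_v w)"
    "hom_v (refl_rbar L w) = k * (- 2 * coef_a L * hom_u w - coef_b L * hom_v w)"
proof (cases L)
  case (VLine x)
  then show ?thesis
    using that[of "if w = None then 1 else - 1"] by (cases w) auto
next
  case (CLine x r)
  then have r: "r > 0" using assms by simp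
  show ?thesis
  proof (cases w)
    case None
    then show ?thesis using that[of "- 1 / 2"] CLine by auto
  next
    case (Some t)
    show ?thesis
    proof (cases "t = x")
      case True
      then show ?thesis
        using that[of "- 1 / (2 * r\<^sup>2)"] CLine Some r
        by (auto simp: field_simps power2_eq_square)
    next
      case False
      then show ?thesis
        using that[of "- 1 / (2 * (t - x))"] CLine Some
        by (auto simp: field_simps power2_eq_square)
    qed
  qed
qed

lemma visual_pos: "Im z0 > 0 \<Longrightarrow> visual z0 w > 0"
  by (cases w) (auto simp: visual_def intro: add_nonneg_pos)

text \<open>A difference of two values of a Moebius map is its determinant, here
  \<open>2 * \<i> * Im z0\<close>, times \<open>wedge\<close>, over both denominators; the squared
  moduli of these are \<open>visual\<close>.\<close>

lemma dist_cayley: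
  assumes "Im z0 > 0"
  shows "(dist (cayley z0 s) (cayley z0 t))\<^sup>2 =
    4 * (Im z0)\<^sup>2 * ((wedge s t)\<^sup>2 / (visual z0 s * visual z0 t))"
proof -
  define p where "p w = of_real (hom_u w) - of_real (hom_v w) * cnj z0" for w
  have p: "(cmod (p w))\<^sup>2 = visual z0 w" for w
    unfolding cmod_power2 p_def visual_def by simp
  have p0: "p w \<noteq> 0" for w
    using p[of w] visual_pos[OF assms, of w] by auto
  have "cayley z0 s - cayley z0 t = (2 * \<i> * of_real (Im z0 * wedge s t)) / (p s * p t)"
    using p0[of s] p0[of t] unfolding cayley_def p_def[symmetric]
    by (simp add: field_simps) (simp add: complex_eq_iff p_def wedge_def algebra_simps)
  then have "(dist (cayley z0 s) (cayley z0 t))\<^sup>2 =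
      (2 * \<bar>Im z0 * wedge s t\<bar>)\<^sup>2 / ((cmod (p s))\<^sup>2 * (cmod (p t))\<^sup>2)"
    by (simp add: dist_norm norm_divide norm_mult power_divide power_mult_distrib)
  then show ?thesis unfolding p by (simp add: power_mult_distrib)
qed

lemma wedge_swap: "wedge s t = - wedge t s" by (simp add: wedge_def)

text \<open>
  In the visual metric from \<open>z0\<close> the reflection contracts at \<open>w\<close> by the factor
  \<open>1 / (1 + gain L z0 w)\<close>, the Poisson kernel at the mirror image of \<open>z0\<close> over that at \<open>z0\<close>.
\<close>

definition gain :: "hline \<Rightarrow> complex \<Rightarrow> rbar \<Rightarrow> real" where
  "gain L z0 w = 4 * bquad L w * quad L z0 / (disc L * visual z0 w)"

section \<open>Chordal contraction by one reflection\<close>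

context
  fixes L z0
  assumes ok: "hline_ok L" and z0: "Im z0 > 0"
begin

lemma visual_refl:
  assumes "hom_u s' = k * (coef_b L * hom_u s + 2 * coef_c L * hom_v s)"
    and "hom_v s' = k * (- 2 * coef_a L * hom_u s - coef_b L * hom_v s)"
  shows "visual z0 s' = k\<^sup>2 * (disc L * (visual z0 s * (1 + gain L z0 s)))"
proof -
  have "visual z0 s' = k\<^sup>2 * (disc L * visual z0 s + 4 * bquad L s * quad L z0)"
    unfolding visual_def assms disc_def bquad_def quad_def cmod_power2 by algebra
  also have "disc L * visual z0 s + 4 * bquad L s * quad L z0 =
      disc L * (visual z0 s * (1 + gain L z0 s))"
    using disc_pos[OF ok] visual_pos[OF z0, of s] by (simp add: gain_def field_simps)
  finally show ?thesis .
qed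

lemma gain_pos_iff: "gain L z0 w > 0 \<longleftrightarrow> bquad L w * quad L z0 > 0"
proof -
  have "gain L z0 w = (bquad L w * quad L z0) * (4 / (disc L * visual z0 w))"
    by (simp add: gain_def)
  moreover have "4 / (disc L * visual z0 w) > 0"
    using disc_pos[OF ok] visual_pos[OF z0, of w] by simp
  ultimately show ?thesis by (metis zero_less_mult_pos2 mult_pos_pos)
qed

text \<open>The reflection scales \<open>wedge\<close> by its determinant and \<open>visual\<close>
  by \<open>disc\<close> times \<open>1 + gain\<close>, so the squared distance is divided by both
  factors \<open>1 + gain\<close>; the one at \<open>t\<close> exceeds 1 and is dropped.\<close>

lemma dist_refl_near_near:
  assumes "gain L z0 s > 0" "gain L z0 t > 0"
  shows "(wedge (refl_rbar L s) (refl_rbar L t))\<^sup>2 /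
      (visual z0 (refl_rbar L s) * visual z0 (refl_rbar L t)) * (1 + gain L z0 s)
    \<le> (wedge s t)\<^sup>2 / (visual z0 s * visual z0 t)"
proof -
  obtain k where k: "k \<noteq> 0"
    "hom_u (refl_rbar L s) = k * (coef_b L * hom_u s + 2 * coef_c L * hom_v s)"
    "hom_v (refl_rbar L s) = k * (- 2 * coef_a L * hom_u s - coef_b L * hom_v s)"
    by (rule refl_rbar_hom[OF ok])
  obtain l where l: "l \<noteq> 0"
    "hom_u (refl_rbar L t) = l * (coef_b L * hom_u t + 2 * coef_c L * hom_v t)"
    "hom_v (refl_rbar L t) = l * (- 2 * coef_a L * hom_u t - coef_b L * hom_v t)"
    by (rule refl_rbar_hom[OF ok])
  have w: "wedge (refl_rbar L s) (refl_rbar L t) = - k * l * disc L * wedge s t"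
    unfolding wedge_def k(2,3) l(2,3) disc_def by algebra
  have pos: "disc L > 0" "visual z0 s > 0" "visual z0 t > 0"
    using disc_pos[OF ok] visual_pos[OF z0] by auto
  define e h where "e = 1 + gain L z0 s" and "h = 1 + gain L z0 t"
  have eh: "e > 0" "h > 0" using assms by (simp_all add: e_def h_def)
  have "(wedge (refl_rbar L s) (refl_rbar L t))\<^sup>2 /
      (visual z0 (refl_rbar L s) * visual z0 (refl_rbar L t)) * (1 + gain L z0 s)
    = (wedge s t)\<^sup>2 / (visual z0 s * visual z0 t) / (1 + gain L z0 t)"
    unfolding w visual_refl[OF k(2,3)] visual_refl[OF l(2,3)] e_def[symmetric] h_def[symmetric]
    using pos k(1) l(1) eh by (simp add: field_simps power2_eq_square)
  also have "\<dots> \<le> (wedge s t)\<^sup>2 / (visual z0 s * visual z0 t) / 1"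
    using pos assms by (intro divide_left_mono) auto
  finally show ?thesis by simp
qed

text \<open>With \<open>m\<close> the polarised form at \<open>s\<close> and \<open>t\<close> (twice
  over), \<open>m\<^sup>2\<close> differs from \<open>disc L * (wedge s t)\<^sup>2\<close> by
  \<open>4 * (bquad L s * bquad L t)\<close>, which is nonpositive since the line separates
  \<open>s\<close> from \<open>t\<close> weakly.\<close>

lemma dist_refl_near_far:
  assumes "gain L z0 s > 0" "\<not> gain L z0 t > 0"
  shows "(wedge (refl_rbar L s) t)\<^sup>2 / (visual z0 (refl_rbar L s) * visual z0 t) * (1 + gain L z0 s)
    \<le> (wedge s t)\<^sup>2 / (visual z0 s * visual z0 t)"
proof -
  obtain k where k: "k \<noteq> 0"
    "hom_u (refl_rbar L s) = k * (coef_b L * hom_u s + 2 * coef_c L * hom_v s)"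
    "hom_v (refl_rbar L s) = k * (- 2 * coef_a L * hom_u s - coef_b L * hom_v s)"
    by (rule refl_rbar_hom[OF ok])
  define m where "m = 2 * coef_a L * hom_u s * hom_u t
    + coef_b L * (hom_u s * hom_v t + hom_u t * hom_v s) + 2 * coef_c L * hom_v s * hom_v t"
  have w: "wedge (refl_rbar L s) t = k * m"
    unfolding wedge_def k(2,3) m_def by algebra
  have "m\<^sup>2 - disc L * (wedge s t)\<^sup>2 = 4 * (bquad L s * bquad L t)"
    unfolding m_def disc_def wedge_def bquad_def by algebra
  moreover have "bquad L s * bquad L t \<le> 0"
    using assms unfolding gain_pos_iff
    by (smt (verit) mult_le_0_iff mult_pos_pos zero_less_mult_iff)
  ultimately have m: "m\<^sup>2 \<le> disc L * (wedge s t)\<^sup>2" by linarith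
  have pos: "disc L > 0" "visual z0 s > 0" "visual z0 t > 0"
    using disc_pos[OF ok] visual_pos[OF z0] by auto
  define e where "e = 1 + gain L z0 s"
  have e: "e > 0" using assms by (simp add: e_def)
  have "(wedge (refl_rbar L s) t)\<^sup>2 / (visual z0 (refl_rbar L s) * visual z0 t) * (1 + gain L z0 s)
    = m\<^sup>2 / (disc L * (visual z0 s * visual z0 t))"
    unfolding w visual_refl[OF k(2,3)] e_def[symmetric]
    using pos k(1) e by (simp add: field_simps power2_eq_square)
  also have "\<dots> \<le> (disc L * (wedge s t)\<^sup>2) / (disc L * (visual z0 s * visual z0 t))"
    using pos m by (intro divide_right_mono) auto
  finally show ?thesis using pos by simp
qed

text \<open>If only \<open>t\<close> moves, the near-far bound applies with the points exchanged;
  its extra factor is given up, as the factor claimed at \<open>s\<close> is then 1.\<close>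

lemma dist_tau:
  "(dist (cayley z0 (tau L z0 s)) (cayley z0 (tau L z0 t)))\<^sup>2 * (1 + max 0 (gain L z0 s))
    \<le> (dist (cayley z0 s) (cayley z0 t))\<^sup>2"
proof -
  define D where "D x y = (wedge x y)\<^sup>2 / (visual z0 x * visual z0 y)" for x y
  have D0: "D x y \<ge> 0" for x y
    unfolding D_def using visual_pos[OF z0] by (intro divide_nonneg_pos mult_pos_pos) auto
  have Dsym: "D x y = D y x" for x y
    unfolding D_def by (subst wedge_swap) (simp add: mult.commute)
  have "D (tau L z0 s) (tau L z0 t) * (1 + max 0 (gain L z0 s)) \<le> D s t"
  proof (cases "gain L z0 s > 0")
    case True
    then show ?thesis
      using dist_refl_near_near[of s t] dist_refl_near_far[of s t]
      unfolding tau_eq[OF ok] gain_pos_iff[symmetric] D_def by (auto simp: max_def)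
  next
    case s: False
    show ?thesis
    proof (cases "gain L z0 t > 0")
      case True
      have "D (refl_rbar L t) s * 1 \<le> D (refl_rbar L t) s * (1 + gain L z0 t)"
        using True D0 by (intro mult_left_mono) auto
      also have "\<dots> \<le> D t s" using dist_refl_near_far[OF True s] unfolding D_def .
      finally show ?thesis
        using s True unfolding tau_eq[OF ok] gain_pos_iff[symmetric]
        by (auto simp: max_def Dsym)
    qed (use s in \<open>auto simp: tau_eq[OF ok] gain_pos_iff[symmetric] max_def\<close>)
  qed
  then have "4 * (Im z0)\<^sup>2 * (D (tau L z0 s) (tau L z0 t) * (1 + max 0 (gain L z0 s)))
      \<le> 4 * (Im z0)\<^sup>2 * D s t"
    by (intro mult_left_mono) auto
  then show ?thesis
    unfolding dist_cayley[OF z0] D_def by (simp add: mult.assoc)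
qed

end

section \<open>Measurability\<close>

lemma space_rbar_borel [simp]: "space rbar_borel = UNIV"
  by (simp add: rbar_borel_def space_measure_of_conv)

lemma rbar_open_in_sets: "rbar_open U \<Longrightarrow> U \<in> sets rbar_borel"
  by (simp add: rbar_borel_def sets_measure_of_conv)

lemma measurable_Some_rbar [measurable]: "Some \<in> measurable borel rbar_borel"
  unfolding rbar_borel_def by (rule measurable_measure_of) (auto simp: rbar_open_def)

text \<open>Finite parts are recovered through a measurable left inverse \<open>g\<close> of
  \<open>Some\<close>. Its value 0 at infinity is arbitrary: \<open>{None}\<close> is removed and
  \<open>N\<close> restores the right membership.\<close>

lemma sets_rbar_borelI:
  assumes "Some -` A \<in> sets (borel :: real measure)"
  shows "A \<in> sets rbar_borel"
proof -
  have Some_open: "Some ` V \<in> sets rbar_borel" if "open V" for V :: "real set"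
    using that by (intro rbar_open_in_sets) (auto simp: rbar_open_def inj_vimage_image_eq)
  have None: "{None} \<in> sets rbar_borel"
  proof -
    have "{None} = space rbar_borel - range Some" by (auto simp: UNIV_option_conv)
    then show ?thesis using sets.compl_sets[OF Some_open[OF open_UNIV]] by metis
  qed
  define g :: "rbar \<Rightarrow> real" where "g w = (case w of Some t \<Rightarrow> t | None \<Rightarrow> 0)" for w
  have g: "g \<in> borel_measurable rbar_borel"
  proof (rule borel_measurableI)
    fix V :: "real set" assume "open V"
    have "g -` V = Some ` V \<union> (if 0 \<in> V then {None} else {})"
      by (auto simp: g_def split: option.splits)
    then show "g -` V \<inter> space rbar_borel \<in> sets rbar_borel"
      using sets.Un[OF Some_open[OF \<open>open V\<close>] None] Some_open[OF \<open>open V\<close>] by auto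
  qed
  define N where "N = (if None \<in> A then {None} else {} :: rbar set)"
  have "g -` (Some -` A) \<in> sets rbar_borel" "N \<in> sets rbar_borel"
    using measurable_sets[OF g assms] None by (simp_all add: N_def)
  then have "(g -` (Some -` A) - {None}) \<union> N \<in> sets rbar_borel"
    using None by blast
  also have "(g -` (Some -` A) - {None}) \<union> N = A"
    by (auto simp: g_def N_def split: option.splits if_splits)
  finally show ?thesis .
qed

lemma measurable_rbar_borelI:
  assumes "(\<lambda>t. g (Some t)) \<in> measurable borel N" "g None \<in> space N"
  shows "g \<in> measurable rbar_borel N"
proof (rule measurableI)
  show "g w \<in> space N" for w
    using assms measurable_space[OF assms(1)] by (cases w) auto
  show "g -` A \<inter> space rbar_borel \<in> sets rbar_borel" if "A \<in> sets N" for A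
    using measurable_sets[OF assms(1) that] by (intro sets_rbar_borelI) (simp add: vimage_def)
qed

lemma tau_measurable [measurable]: "tau L z0 \<in> measurable rbar_borel rbar_borel"
proof (rule measurable_rbar_borelI)
  have [measurable]: "(\<lambda>t. refl_rbar L (Some t)) \<in> borel \<rightarrow>\<^sub>M rbar_borel"
    by (cases L) simp_all
  have [measurable]: "(\<lambda>t. side_rbar L (Some t)) \<in> borel_measurable borel"
    by (cases L) simp_all
  show "(\<lambda>t. tau L z0 (Some t)) \<in> borel \<rightarrow>\<^sub>M rbar_borel"
    unfolding tau_def by measurable
qed simp

text \<open>\<open>Re\<close> makes the map total, since off the unit circle the quotient need not
  be real. The value 1 corresponds to infinity.\<close>

definition inv_cayley :: "complex \<Rightarrow> complex \<Rightarrow> rbar" where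
  "inv_cayley z0 w = (if w = 1 then None else Some (Re ((z0 - w * cnj z0) / (1 - w))))"

lemma cayley_measurable: "cayley z0 \<in> borel_measurable rbar_borel"
  by (rule measurable_rbar_borelI) (simp_all add: cayley_def)

lemma inv_cayley_measurable: "inv_cayley z0 \<in> measurable borel rbar_borel"
  unfolding inv_cayley_def by measurable

lemma inv_cayley_cayley:
  assumes "Im z0 > 0"
  shows "inv_cayley z0 (cayley z0 w) = w"
proof (cases w)
  case (Some t)
  have 1: "of_real t - cnj z0 \<noteq> 0" "z0 - cnj z0 \<noteq> 0"
    using assms by (auto simp: complex_eq_iff)
  have c: "cayley z0 w = (of_real t - z0) / (of_real t - cnj z0)"
    by (simp add: Some cayley_def)
  then have "1 - cayley z0 w = (z0 - cnj z0) / (of_real t - cnj z0)"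
    using 1 by (simp add: field_simps)
  moreover have "z0 - cayley z0 w * cnj z0 = of_real t * (z0 - cnj z0) / (of_real t - cnj z0)"
    unfolding c using 1 by (simp add: field_simps)
  moreover from calculation have "cayley z0 w \<noteq> 1" using 1 by auto
  ultimately show ?thesis using 1 by (simp add: inv_cayley_def Some)
qed (simp add: inv_cayley_def cayley_def)

lemma range_cayley:
  assumes "Im z0 > 0"
  shows "range (cayley z0) = sphere 0 1"
proof (intro equalityI subsetI)
  fix w assume "w \<in> range (cayley z0)"
  then obtain x where x: "w = cayley z0 x" by auto
  define p where "p = of_real (hom_u x) - of_real (hom_v x) * z0"
  have "p \<noteq> 0" using assms by (cases x) (auto simp: p_def complex_eq_iff)
  moreover have "w = p / cnj p" by (simp add: x cayley_def p_def)
  ultimately show "w \<in> sphere 0 1" by (simp add: norm_divide)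
next
  fix w :: complex assume "w \<in> sphere 0 1"
  then have w: "w * cnj w = 1" by (simp add: complex_norm_square[symmetric])
  show "w \<in> range (cayley z0)"
  proof (cases "w = 1")
    case True
    then have "w = cayley z0 None" by (simp add: cayley_def)
    then show ?thesis by blast
  next
    case False
    \<comment> \<open>The solution of the Moebius equation for the preimage of \<open>w\<close>;
      \<open>w * cnj w = 1\<close> makes it its own conjugate, hence real.\<close>
    define t where "t = (z0 - w * cnj z0) / (1 - w)"
    have "w \<noteq> 0" using w by auto
    have nz: "1 - w \<noteq> 0" "z0 - cnj z0 \<noteq> 0" "1 - cnj w \<noteq> 0"
      using assms False by (auto simp: complex_eq_iff)
    have "cnj t = (w * (cnj z0 - cnj w * z0)) / (w * (1 - cnj w))"
      using \<open>w \<noteq> 0\<close> by (simp add: t_def)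
    also have "w * (cnj z0 - cnj w * z0) = - (z0 - w * cnj z0)"
      using w by (simp add: algebra_simps)
    also have "w * (1 - cnj w) = - (1 - w)" using w by (simp add: algebra_simps)
    finally have "cnj t = t" by (simp only: t_def minus_divide_divide)
    then have t: "of_real (Re t) = t" by (simp add: complex_eq_iff)
    have "t - z0 = w * (z0 - cnj z0) / (1 - w)" "t - cnj z0 = (z0 - cnj z0) / (1 - w)"
      using nz by (simp_all add: t_def field_simps)
    then have "cayley z0 (Some (Re t)) = w"
      using nz t by (simp add: cayley_def)
    then show ?thesis by (metis rangeI)
  qed
qed

section \<open>Pairs of lines\<close>

text \<open>The polarisation of \<open>disc\<close>: a Lorentzian product of signature (2,1), for
  which lines are spacelike.\<close>

definition pairing :: "hline \<Rightarrow> hline \<Rightarrow> real" where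
  "pairing L L' = coef_b L * coef_b L' - 2 * (coef_a L * coef_c L' + coef_a L' * coef_c L)"

lemma pairing_self: "pairing L L = disc L"
  by (simp add: pairing_def disc_def power2_eq_square)

text \<open>
  Coordinates for the pencil of the geodesic from \<open>w\<close> through \<open>z0\<close>: \<open>A\<close> and \<open>C\<close> are the values
  of the forms at the two endpoints, \<open>B\<close> the component orthogonal to the pencil.
\<close>

lemma pencil_coordinates:
  assumes "Im z0 > 0"
  obtains A B C :: "hline \<Rightarrow> real" where "\<And>L. C L = bquad L w"
    "\<And>L L'. pairing L L' = B L * B L' - 2 * (A L * C L' + A L' * C L)"
    "\<And>L e. e * quad L z0 > 0 \<Longrightarrow> e * C L \<le> 0 \<Longrightarrow> e * A L > 0"
proof (cases w)
  case None
  let ?x = "Re z0"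
  show ?thesis
  proof (rule that)
    show "coef_a L = bquad L w" for L by (simp add: None bquad_def)
    show "pairing L L' = (2 * coef_a L * ?x + coef_b L) * (2 * coef_a L' * ?x + coef_b L')
      - 2 * ((coef_a L * ?x\<^sup>2 + coef_b L * ?x + coef_c L) * coef_a L'
        + (coef_a L' * ?x\<^sup>2 + coef_b L' * ?x + coef_c L') * coef_a L)" for L L'
      unfolding pairing_def by algebra
    show "e * (coef_a L * ?x\<^sup>2 + coef_b L * ?x + coef_c L) > 0"
      if "e * quad L z0 > 0" "e * coef_a L \<le> 0" for e L
    proof -
      have "e * quad L z0 = e * (coef_a L * ?x\<^sup>2 + coef_b L * ?x + coef_c L) + e * coef_a L * (Im z0)\<^sup>2"
        unfolding quad_def cmod_power2 by (simp add: algebra_simps)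
      moreover have "e * coef_a L * (Im z0)\<^sup>2 \<le> 0"
        using that by (intro mult_nonpos_nonneg[of "e * coef_a L"]) auto
      ultimately show ?thesis using that by linarith
    qed
  qed
next
  case (Some t)
  define x where "x = Re z0 - t"
  define d where "d = x\<^sup>2 + (Im z0)\<^sup>2"
  have d: "d > 0" using assms by (simp add: d_def add_nonneg_pos)
  \<comment> \<open>The geodesic from \<open>t\<close> through \<open>z0\<close> ends at
    \<open>t + 1 / k\<close>, or at infinity if \<open>k = 0\<close>. \<open>A\<close> is the form
    at the homogeneous coordinates \<open>1 + k * t : k\<close> of that endpoint.\<close>
  define k where "k = x / d"
  define C where "C L = coef_a L * t\<^sup>2 + coef_b L * t + coef_c L" for L
  define B0 where "B0 L = 2 * coef_a L * t + coef_b L" for L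
  define A where "A L = coef_a L + B0 L * k + C L * k\<^sup>2" for L
  define B where "B L = B0 L + 2 * C L * k" for L
  show ?thesis
  proof (rule that)
    show "C L = bquad L w" for L by (simp add: Some bquad_def C_def)
    show "pairing L L' = B L * B L' - 2 * (A L * C L' + A L' * C L)" for L L'
      unfolding pairing_def B_def A_def B0_def C_def by algebra
    show "e * A L > 0" if "e * quad L z0 > 0" "e * C L \<le> 0" for e L
    proof -
      have "quad L z0 = coef_a L * d + B0 L * x + C L"
        unfolding quad_def cmod_power2 d_def x_def B0_def C_def
        by (simp add: algebra_simps power2_eq_square)
      \<comment> \<open>The value at \<open>z0\<close> is a combination of the endpoint values
        \<open>A\<close> and \<open>C\<close> with positive weights.\<close>
      then have "d * A L = quad L z0 - C L * (1 - x * k)"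
        using d by (simp add: A_def k_def field_simps power2_eq_square)
      also have "1 - x * k = (Im z0)\<^sup>2 / d"
        using d by (simp add: k_def divide_simps) (simp add: d_def power2_eq_square)
      finally have "e * (d * A L) = e * quad L z0 - e * C L * ((Im z0)\<^sup>2 / d)"
        by (simp only: right_diff_distrib mult.assoc)
      moreover have "e * C L * ((Im z0)\<^sup>2 / d) \<le> 0"
        using that d by (intro mult_nonpos_nonneg[of "e * C L"]) auto
      ultimately have "d * (e * A L) > 0" using that by (simp add: algebra_simps)
      then show ?thesis using d by (simp add: zero_less_mult_iff)
    qed
  qed
qed

section \<open>No boundary point on the far side of all three lines\<close>

lemma nonneg_pair_of_three:
  fixes x y z :: real
  shows "x * y \<ge> 0 \<or> y * z \<ge> 0 \<or> x * z \<ge> 0"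
  by (cases "x \<ge> 0"; cases "y \<ge> 0"; cases "z \<ge> 0") (auto simp: zero_le_mult_iff)

lemma ex_near_side:
  assumes z0: "Im z0 > 0"
    and ok: "hline_ok L1" "hline_ok L2" "hline_ok L3"
    and nz: "quad L1 z0 \<noteq> 0" "quad L2 z0 \<noteq> 0" "quad L3 z0 \<noteq> 0"
    and p12: "quad L1 z0 * quad L2 z0 * pairing L1 L2 \<le> 0"
    and p23: "quad L2 z0 * quad L3 z0 * pairing L2 L3 \<le> 0"
    and p13: "quad L1 z0 * quad L3 z0 * pairing L1 L3 \<le> 0"
  shows "bquad L1 w * quad L1 z0 > 0 \<or> bquad L2 w * quad L2 z0 > 0 \<or> bquad L3 w * quad L3 z0 > 0"
proof (rule ccontr)
  assume neg: "\<not> ?thesis"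
  obtain A B C where abc: "\<And>L. C L = bquad L w"
    "\<And>L L'. pairing L L' = B L * B L' - 2 * (A L * C L' + A L' * C L)"
    "\<And>L e. e * quad L z0 > 0 \<Longrightarrow> e * C L \<le> 0 \<Longrightarrow> e * A L > 0"
    using pencil_coordinates[OF z0, of w] by metis
  have step: False
    if ok: "hline_ok L" "hline_ok L'" and nz: "quad L z0 \<noteq> 0" "quad L' z0 \<noteq> 0"
      and c: "quad L z0 * C L \<le> 0" "quad L' z0 * C L' \<le> 0"
      and p: "quad L z0 * quad L' z0 * pairing L L' \<le> 0"
      and B: "(quad L z0 * B L) * (quad L' z0 * B L') \<ge> 0" for L L'
  proof -
    have a: "quad L z0 * A L > 0" "quad L' z0 * A L' > 0"
    proof -
      have "quad L z0 * quad L z0 > 0" "quad L' z0 * quad L' z0 > 0"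
        using nz by (simp_all add: zero_less_mult_iff linorder_neq_iff disj_commute)
      then show "quad L z0 * A L > 0" "quad L' z0 * A L' > 0"
        using abc(3) c by blast+
    qed
    have "quad L z0 * quad L' z0 * pairing L L' = (quad L z0 * B L) * (quad L' z0 * B L')
      - 2 * ((quad L z0 * A L) * (quad L' z0 * C L') + (quad L' z0 * A L') * (quad L z0 * C L))"
      unfolding abc(2) by algebra
    moreover have "(quad L z0 * A L) * (quad L' z0 * C L') \<le> 0"
      "(quad L' z0 * A L') * (quad L z0 * C L) \<le> 0"
      using a c by (auto intro: mult_nonneg_nonpos)
    moreover have zero: "u = 0 \<and> v = 0 \<and> y = 0"
      if "x = y - 2 * (u + v)" "u \<le> 0" "v \<le> 0" "x \<le> 0" "0 \<le> y" for x y u v :: real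
      using that by (smt (verit))
    ultimately have "(quad L z0 * A L) * (quad L' z0 * C L') = 0"
      "(quad L' z0 * A L') * (quad L z0 * C L) = 0"
      "(quad L z0 * B L) * (quad L' z0 * B L') = 0"
      using p B zero by metis+
    \<comment> \<open>The oriented pairing is nonpositive, yet a sum of nonnegative terms, so all of
      them vanish. One form then has \<open>B = C = 0\<close> and is a null vector, against
      \<open>disc > 0\<close>.\<close>
    then have "C L = 0" "C L' = 0" "B L = 0 \<or> B L' = 0"
      using a nz by auto
    then have "disc L = 0 \<or> disc L' = 0"
      by (auto simp: pairing_self[symmetric] abc(2))
    then show False using disc_pos[OF ok(1)] disc_pos[OF ok(2)] by auto
  qed
  have c: "quad L1 z0 * C L1 \<le> 0" "quad L2 z0 * C L2 \<le> 0" "quad L3 z0 * C L3 \<le> 0"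
    using neg by (simp_all add: abc(1) mult.commute not_less)
  show False
    using nonneg_pair_of_three[of "quad L1 z0 * B L1" "quad L2 z0 * B L2" "quad L3 z0 * B L3"]
      step[OF ok(1,2) nz(1,2) c(1,2) p12] step[OF ok(2,3) nz(2,3) c(2,3) p23]
      step[OF ok(1,3) nz(1,3) c(1,3) p13] by blast
qed

section \<open>Signs of the forms on a component and its frontier\<close>

lemma quad_eq_0_iff:
  assumes "hline_ok L" "Im z > 0"
  shows "quad L z = 0 \<longleftrightarrow> z \<in> hset L"
proof -
  have "quad L z = 0 \<longleftrightarrow> side L z = 0"
    using sgn_side[OF assms(1), of z] by (metis sgn_0_0)
  also have "\<dots> \<longleftrightarrow> z \<in> hset L" using assms(2) by (cases L) auto
  finally show ?thesis .
qed

lemma hset_Im: "z \<in> hset L \<Longrightarrow> Im z > 0"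
  by (cases L) auto

lemma pairing_commute: "pairing L L' = pairing L' L"
  by (simp add: pairing_def algebra_simps)

lemma continuous_on_quad: "continuous_on S (quad L)"
  unfolding quad_def by (intro continuous_intros)

text \<open>The form has no zero on the component, so it keeps its sign there by connectedness, and
  weakly on the closure. A frontier point shows the component to be nonempty, which puts
  \<open>z0\<close> in \<open>S\<close>.\<close>

lemma frontier_component_quad:
  assumes ok: "hline_ok L" and S: "S \<subseteq> uhp - hset L"
    and w: "w \<in> frontier (connected_component_set S z0)"
  shows "quad L z0 \<noteq> 0" "quad L z0 * quad L w \<ge> 0"
proof -
  define C where "C = connected_component_set S z0"
  have "C \<noteq> {}" using w frontier_empty unfolding C_def by (metis empty_iff)
  then have "z0 \<in> S" using connected_component_eq_empty[of S z0] unfolding C_def by blast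
  then have z0: "z0 \<in> C" by (simp add: C_def connected_component_refl)
  have nz: "quad L z \<noteq> 0" if "z \<in> C" for z
  proof -
    have "z \<in> S" using that connected_component_subset[of S z0] unfolding C_def by (rule subsetD[rotated])
    then show ?thesis using quad_eq_0_iff[OF ok, of z] S by (auto simp: uhp_def)
  qed
  show "quad L z0 \<noteq> 0" using nz z0 .
  have conn: "connected (quad L ` C)"
    unfolding C_def by (intro connected_continuous_image continuous_on_quad) simp
  have pos: "quad L z0 * quad L z \<ge> 0" if z: "z \<in> C" for z
  proof (rule ccontr)
    assume "\<not> ?thesis"
    then have "0 \<in> {quad L z0..quad L z} \<or> 0 \<in> {quad L z..quad L z0}"
      by (auto simp: not_le mult_less_0_iff)
    then have "0 \<in> quad L ` C"
      using connected_contains_Icc[OF conn imageI[OF z0] imageI[OF z]]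
        connected_contains_Icc[OF conn imageI[OF z] imageI[OF z0]] by blast
    then show False using nz by auto
  qed
  have "closed {z. quad L z0 * quad L z \<ge> 0}"
    by (intro closed_Collect_le continuous_intros continuous_on_quad)
  then have "closure C \<subseteq> {z. quad L z0 * quad L z \<ge> 0}"
    using pos by (intro closure_minimal) auto
  then show "quad L z0 * quad L w \<ge> 0"
    using w by (auto simp: frontier_def C_def)
qed

section \<open>Pairs of disjoint lines\<close>

lemma circles_meet:
  fixes d r1 r2 :: real
  assumes "d \<noteq> 0" "(d\<^sup>2 + r2\<^sup>2 - r1\<^sup>2)\<^sup>2 < 4 * d\<^sup>2 * r2\<^sup>2"
  obtains x y where "y > 0" "x\<^sup>2 + y\<^sup>2 = r2\<^sup>2" "(x - d)\<^sup>2 + y\<^sup>2 = r1\<^sup>2"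
proof -
  \<comment> \<open>The abscissa of the common chord of the circles about 0 (radius
    \<open>r2\<close>) and about \<open>d\<close> (radius \<open>r1\<close>); the hypothesis says
    that it lies within the radius \<open>r2\<close>.\<close>
  define x where "x = (d\<^sup>2 + r2\<^sup>2 - r1\<^sup>2) / (2 * d)"
  have dx: "2 * d * x = d\<^sup>2 + r2\<^sup>2 - r1\<^sup>2" using assms(1) by (simp add: x_def)
  have "4 * d\<^sup>2 * x\<^sup>2 < 4 * d\<^sup>2 * r2\<^sup>2"
    using assms(2) unfolding dx[symmetric] by (simp add: power_mult_distrib)
  then have "x\<^sup>2 < r2\<^sup>2" using assms(1) by simp
  moreover have "(x - d)\<^sup>2 + (r2\<^sup>2 - x\<^sup>2) = r1\<^sup>2"
    using dx by (simp add: power2_eq_square algebra_simps)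
  ultimately show ?thesis
    using that[of "sqrt (r2\<^sup>2 - x\<^sup>2)" x] by simp
qed

text \<open>\<open>d\<close> is the difference of the centres and \<open>e\<close>,
  \<open>e'\<close> the values of the forms at \<open>z0\<close>. \<open>P\<close> and
  \<open>R\<close> are the sign conditions at the tops of the circles; \<open>disj\<close> negates
  the hypothesis of \<open>circles_meet\<close>. Opposite signs correspond to nested
  circles.\<close>

lemma disjoint_circles:
  fixes e e' d r1 r2 :: real
  assumes r: "r1 > 0" "r2 > 0" and e: "e \<noteq> 0" "e' \<noteq> 0"
    and P: "e' * (d\<^sup>2 + r1\<^sup>2 - r2\<^sup>2) \<ge> 0" and R: "e * (d\<^sup>2 + r2\<^sup>2 - r1\<^sup>2) \<ge> 0"
    and ne: "d = 0 \<Longrightarrow> r1 \<noteq> r2"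
    and disj: "d \<noteq> 0 \<Longrightarrow> (d\<^sup>2 + r2\<^sup>2 - r1\<^sup>2)\<^sup>2 \<ge> 4 * d\<^sup>2 * r2\<^sup>2"
  shows "e * e' * (r1\<^sup>2 + r2\<^sup>2 - d\<^sup>2) \<le> 0"
proof (cases "e * e' < 0")
  case True
  have "r1\<^sup>2 + r2\<^sup>2 - d\<^sup>2 \<ge> 0"
  proof (cases "e < 0")
    case True
    then have "d\<^sup>2 + r2\<^sup>2 - r1\<^sup>2 \<le> 0" using R by (simp add: zero_le_mult_iff)
    then show ?thesis using zero_le_power2[of r2] by linarith
  next
    case False
    then have "e' < 0" using True by (simp add: mult_less_0_iff)
    then have "d\<^sup>2 + r1\<^sup>2 - r2\<^sup>2 \<le> 0" using P by (simp add: zero_le_mult_iff)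
    then show ?thesis using zero_le_power2[of r1] by linarith
  qed
  then show ?thesis using True by (simp add: mult_nonpos_nonneg)
next
  case False
  have sq: "d\<^sup>2 > 0" if "d \<noteq> 0" using that by simp
  \<comment> \<open>Two negative signs would put the top of each circle weakly inside the other and
    force equal circles.\<close>
  have "e > 0 \<and> e' > 0 \<and> d \<noteq> 0"
  proof (cases "e > 0")
    case True
    then have "e' > 0" using False e by (auto simp: mult_less_0_iff linorder_neq_iff)
    moreover have "d \<noteq> 0"
    proof
      assume "d = 0"
      then have "r1\<^sup>2 = r2\<^sup>2" using P R True \<open>e' > 0\<close> by (simp add: zero_le_mult_iff)
      then show False using ne[OF \<open>d = 0\<close>] r by simp
    qed
    ultimately show ?thesis using True by simp
  next
    case e_neg: False
    then have "e < 0" "e' < 0" using False e by (auto simp: mult_less_0_iff linorder_neq_iff)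
    then have le: "d\<^sup>2 + r1\<^sup>2 - r2\<^sup>2 \<le> 0" "d\<^sup>2 + r2\<^sup>2 - r1\<^sup>2 \<le> 0"
      using P R by (simp_all add: zero_le_mult_iff)
    then have "d = 0" using sq by fastforce
    then have "r1\<^sup>2 = r2\<^sup>2" using le by simp
    then show ?thesis using ne[OF \<open>d = 0\<close>] r by simp
  qed
  then have e: "e > 0" "e' > 0" and d: "d \<noteq> 0" by auto
  have P': "d\<^sup>2 + r1\<^sup>2 - r2\<^sup>2 \<ge> 0" and R': "d\<^sup>2 + r2\<^sup>2 - r1\<^sup>2 \<ge> 0"
    using P R e by (simp_all add: zero_le_mult_iff)
  have prod: "(d\<^sup>2 - (r1 + r2)\<^sup>2) * (d\<^sup>2 - (r1 - r2)\<^sup>2) \<ge> 0"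
  proof -
    have "(d\<^sup>2 - (r1 + r2)\<^sup>2) * (d\<^sup>2 - (r1 - r2)\<^sup>2) = (d\<^sup>2 + r2\<^sup>2 - r1\<^sup>2)\<^sup>2 - 4 * d\<^sup>2 * r2\<^sup>2"
      by algebra
    then show ?thesis using disj[OF d] by linarith
  qed
  \<comment> \<open>By \<open>prod\<close> the circles are nested or separated; \<open>P'\<close>
    and \<open>R'\<close> exclude nesting.\<close>
  have "d\<^sup>2 > (r1 - r2)\<^sup>2"
  proof (cases "r1 = r2")
    case True then show ?thesis using sq[OF d] by simp
  next
    case False
    show ?thesis
    proof (cases "r1 > r2")
      case True
      then have "(r1 - r2) * r2 > 0" using r by simp
      then have "(r1 - r2)\<^sup>2 < r1\<^sup>2 - r2\<^sup>2" by (simp add: power2_eq_square algebra_simps)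
      then show ?thesis using R' by linarith
    next
      case False
      then have "(r2 - r1) * r1 > 0" using r \<open>r1 \<noteq> r2\<close> by simp
      then have "(r1 - r2)\<^sup>2 < r2\<^sup>2 - r1\<^sup>2" by (simp add: power2_eq_square algebra_simps)
      then show ?thesis using P' by linarith
    qed
  qed
  then have "d\<^sup>2 \<ge> (r1 + r2)\<^sup>2" using prod by (simp add: zero_le_mult_iff)
  then have "r1\<^sup>2 + r2\<^sup>2 - d\<^sup>2 \<le> - 2 * (r1 * r2)" by (simp add: power2_eq_square algebra_simps)
  also have "\<dots> \<le> 0" using r by simp
  finally show ?thesis using e by (simp add: mult_nonneg_nonpos)
qed

lemma disjoint_config_V_C:
  assumes ok: "hline_ok (CLine x r)"
    and e: "e' \<noteq> 0"
    and L: "\<And>w. w \<in> hset (VLine x') \<Longrightarrow> e' * quad (CLine x r) w \<ge> 0"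
    and L': "\<And>w. w \<in> hset (CLine x r) \<Longrightarrow> e * quad (VLine x') w \<ge> 0"
  shows "e * e' * pairing (VLine x') (CLine x r) \<le> 0"
proof -
  have r: "r > 0" using ok by simp
  \<comment> \<open>At height \<open>2 * r\<close> the vertical line is above the circle, hence
    outside it; this test point fixes the sign of \<open>e'\<close>.\<close>
  have "e' * ((x' - x)\<^sup>2 + 3 * r\<^sup>2) \<ge> 0"
    using L[of "Complex x' (2 * r)"] r
    unfolding quad_def cmod_power2 by (simp add: power2_eq_square algebra_simps)
  moreover have "(x' - x)\<^sup>2 + 3 * r\<^sup>2 > 0" using r by (simp add: add_nonneg_pos)
  ultimately have "e' > 0" using e by (simp add: zero_le_mult_iff less_le)
  moreover have "e * (x - x') \<ge> 0"
    using L'[of "Complex x r"] r by (simp add: quad_def cmod_def complex_of_real_def complex_diff)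
  ultimately have "e' * (e * (x - x')) \<ge> 0" by simp
  then show ?thesis by (simp add: pairing_def algebra_simps)
qed

text \<open>All of each line lies in the frontier, hence weakly on the \<open>z0\<close> side of the
  other line. Testing this at one point of each line, together with disjointness, decides the
  sign.\<close>

lemma disjoint_config_pairing:
  assumes ok: "hline_ok L" "hline_ok L'" and conf: "disjoint_config L L' z0"
  shows "quad L z0 * quad L' z0 * pairing L L' \<le> 0"
    and "quad L z0 \<noteq> 0" "quad L' z0 \<noteq> 0"
proof -
  define F where "F = frontier (connected_component_set (uhp - (hset L \<union> hset L')) z0)"
  have disj: "hset L \<inter> hset L' = {}" and F: "hset L \<subseteq> F" "hset L' \<subseteq> F"
    using conf unfolding disjoint_config_def F_def by auto
  have "hset L \<noteq> {}"
  proof (cases L)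
    case (VLine x)
    then have "Complex x 1 \<in> hset L" by simp
    then show ?thesis by blast
  next
    case (CLine x r)
    then have "Complex x r \<in> hset L" using ok by (simp add: cmod_def complex_of_real_def complex_diff)
    then show ?thesis by blast
  qed
  then obtain w where "w \<in> F" using F by blast
  have sub: "uhp - (hset L \<union> hset L') \<subseteq> uhp - hset L" "uhp - (hset L \<union> hset L') \<subseteq> uhp - hset L'"
    by auto
  show nz: "quad L z0 \<noteq> 0" "quad L' z0 \<noteq> 0"
    using frontier_component_quad(1)[OF ok(1) sub(1) \<open>w \<in> F\<close>[unfolded F_def]]
      frontier_component_quad(1)[OF ok(2) sub(2) \<open>w \<in> F\<close>[unfolded F_def]] .
  have L: "quad L' z0 * quad L' w \<ge> 0" if "w \<in> hset L" for w
    using frontier_component_quad(2)[OF ok(2) sub(2)] F(1) that by (simp add: F_def subset_iff)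
  have L': "quad L z0 * quad L w \<ge> 0" if "w \<in> hset L'" for w
    using frontier_component_quad(2)[OF ok(1) sub(1)] F(2) that by (simp add: F_def subset_iff)
  define e e' where "e = quad L z0" and "e' = quad L' z0"
  note nz = nz[folded e_def e'_def] and L = L[folded e'_def] and L' = L'[folded e_def]
  have "e * e' * pairing L L' \<le> 0"
  proof (cases L)
    case V: (VLine x)
    show ?thesis
    proof (cases L')
      case V': (VLine x')
      have "e' * (x - x') \<ge> 0" using L[of "Complex x 1"] by (simp add: V V' quad_def)
      moreover have "e * (x' - x) \<ge> 0" using L'[of "Complex x' 1"] by (simp add: V V' quad_def)
      ultimately have "(e' * (x - x')) * (e * (x' - x)) \<ge> 0" by simp
      then have "e * e' * (x - x')\<^sup>2 \<le> 0" by (simp add: power2_eq_square algebra_simps)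
      moreover have "x \<noteq> x'"
      proof
        assume "x = x'"
        then have "Complex x 1 \<in> hset L \<inter> hset L'" by (simp add: V V')
        then show False using disj by blast
      qed
      then have "(x - x')\<^sup>2 > 0" by simp
      ultimately have "e * e' \<le> 0" by (simp add: mult_le_0_iff)
      then show ?thesis by (simp add: V V' pairing_def)
    next
      case C': (CLine x' r')
      show ?thesis
        using disjoint_config_V_C[of x' r' e' x e] ok nz L L' by (simp add: V C')
    qed
  next
    case C: (CLine x r)
    show ?thesis
    proof (cases L')
      case V': (VLine x')
      show ?thesis
        using disjoint_config_V_C[of x r e x' e'] ok nz L L'
        by (simp add: C V' pairing_commute[of "CLine x r"] mult.commute[of e])
    next
      case C': (CLine x' r')
      have r: "r > 0" "r' > 0" using ok C C' by auto
      have "e * e' * (r\<^sup>2 + r'\<^sup>2 - (x - x')\<^sup>2) \<le> 0"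
      proof (rule disjoint_circles[OF r nz])
        show "e' * ((x - x')\<^sup>2 + r\<^sup>2 - r'\<^sup>2) \<ge> 0"
          using L[of "Complex x r"] r
          by (simp add: C C' quad_def cmod_def complex_of_real_def complex_diff)
            (simp add: power2_eq_square algebra_simps)
        show "e * ((x - x')\<^sup>2 + r'\<^sup>2 - r\<^sup>2) \<ge> 0"
          using L'[of "Complex x' r'"] r
          by (simp add: C C' quad_def cmod_def complex_of_real_def complex_diff)
            (simp add: power2_eq_square algebra_simps)
        show "r \<noteq> r'" if "x - x' = 0"
          using disj that \<open>hset L \<noteq> {}\<close> by (auto simp: C C')
        show "((x - x')\<^sup>2 + r'\<^sup>2 - r\<^sup>2)\<^sup>2 \<ge> 4 * (x - x')\<^sup>2 * r'\<^sup>2" if d: "x - x' \<noteq> 0"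
        proof (rule ccontr)
          assume "\<not> ?thesis"
          then have lt: "((x - x')\<^sup>2 + r'\<^sup>2 - r\<^sup>2)\<^sup>2 < 4 * (x - x')\<^sup>2 * r'\<^sup>2" by simp
          obtain u y where uy: "y > 0" "u\<^sup>2 + y\<^sup>2 = r'\<^sup>2" "(u - (x - x'))\<^sup>2 + y\<^sup>2 = r\<^sup>2"
            by (rule circles_meet[OF d lt])
          have "Complex (u + x') y \<in> hset L \<inter> hset L'"
            using uy r by (simp add: C C' cmod_def complex_of_real_def complex_diff algebra_simps)
          then show False using disj by blast
        qed
      qed
      moreover have "pairing L L' = 2 * (r\<^sup>2 + r'\<^sup>2 - (x - x')\<^sup>2)"
        by (simp add: C C' pairing_def power2_eq_square algebra_simps)
      ultimately show ?thesis by (simp only: mult.left_commute[of "e * e'" 2] mult_le_0_iff) simp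
    qed
  qed
  then show "quad L z0 * quad L' z0 * pairing L L' \<le> 0" by (simp add: e_def e'_def)
qed

section \<open>Pairs of lines meeting at an angle\<close>

lemma arc_component_at_nontrivial:
  fixes \<gamma> :: "real \<Rightarrow> 'a::t2_space"
  assumes J: "open J" "connected J" and cont: "continuous_on J \<gamma>" and inj: "inj_on \<gamma> J"
    and t0: "t0 \<in> J" and R: "R \<in> components (\<gamma> ` J - {\<gamma> t0})"
  shows "at (\<gamma> t0) within R \<noteq> bot"
proof -
  \<comment> \<open>\<open>T\<close> will be the half-line at \<open>t0\<close> on the side of
    \<open>t1\<close>. The image of \<open>J \<inter> T\<close> is connected and avoids
    \<open>\<gamma> t0\<close>, so it lies in \<open>R\<close>; approaching \<open>t0\<close> within
    \<open>T\<close> thus approaches \<open>\<gamma> t0\<close> within \<open>R\<close>.\<close>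
  have aux: "at (\<gamma> t0) within R \<noteq> bot"
    if T: "t0 \<notin> T" "connected (J \<inter> T)" "t1 \<in> J \<inter> T" "\<gamma> t1 \<in> R" "at t0 within T \<noteq> bot" for T t1
  proof
    assume bot: "at (\<gamma> t0) within R = bot"
    have ne: "\<gamma> t \<noteq> \<gamma> t0" if "t \<in> J \<inter> T" for t
      using inj_onD[OF inj] that T(1) t0 by auto
    have "connected (\<gamma> ` (J \<inter> T))"
      using T(2) cont by (intro connected_continuous_image) (auto intro: continuous_on_subset)
    then have sub: "\<gamma> ` (J \<inter> T) \<subseteq> R"
      using T(3,4) ne by (intro components_maximal[OF R]) auto
    have eq: "at t0 within (J \<inter> T) = at t0 within T"
      using J(1) t0 by (intro at_within_nhd[of t0 J]) auto
    have "(\<gamma> \<longlongrightarrow> \<gamma> t0) (at t0 within (J \<inter> T))"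
      using cont t0 by (auto simp: continuous_on_def intro: tendsto_within_subset)
    then have "filterlim \<gamma> (at (\<gamma> t0) within R) (at t0 within (J \<inter> T))"
      using sub ne by (auto simp: filterlim_at eventually_at_filter intro!: always_eventually)
    then have "at t0 within T = bot"
      unfolding eq bot by (simp add: filterlim_def filtermap_bot_iff bot_unique)
    then show False using T(5) by simp
  qed
  obtain q where "q \<in> R" using in_components_nonempty[OF R] by blast
  then obtain t1 where t1: "t1 \<in> J" "t1 \<noteq> t0" "\<gamma> t1 \<in> R"
    using in_components_subset[OF R] by blast
  have int: "is_interval J" using J(2) by (simp add: is_interval_connected_1)
  show ?thesis
  proof (cases "t1 > t0")
    case True
    show ?thesis
    proof (rule aux)
      show "connected (J \<inter> {t0<..})"
        by (intro is_interval_connected is_interval_Int int) (simp add: is_interval_connected_1)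
      show "t1 \<in> J \<inter> {t0<..}" using t1(1) True by simp
      show "at_right t0 \<noteq> bot" by (rule trivial_limit_at_right_real)
    qed (use t1(3) in simp_all)
  next
    case False
    show ?thesis
    proof (rule aux)
      show "connected (J \<inter> {..<t0})"
        by (intro is_interval_connected is_interval_Int int) (simp add: is_interval_connected_1)
      show "t1 \<in> J \<inter> {..<t0}" using t1(1,2) False by simp
      show "at_left t0 \<noteq> bot" by (rule trivial_limit_at_left_real)
    qed (use t1(3) in simp_all)
  qed
qed

text \<open>A ray accumulates at its vertex; otherwise the limits that define the tangent directions
  in \<open>angle_config\<close> would be vacuous.\<close>

lemma hset_component_at_nontrivial:
  assumes ok: "hline_ok L" and p: "p \<in> hset L" and R: "R \<in> components (hset L - {p})"
  shows "at p within R \<noteq> bot"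
proof -
  have "\<exists>(\<gamma> :: real \<Rightarrow> complex) J. open J \<and> connected J \<and> continuous_on J \<gamma> \<and> inj_on \<gamma> J \<and> \<gamma> ` J = hset L"
  proof (cases L)
    case (VLine x)
    have "(\<lambda>t. Complex x t) ` {0<..} = hset L"
      by (auto simp: VLine image_iff complex_eq_iff)
    moreover have "continuous_on {0<..} (\<lambda>t. Complex x t)"
      by (intro continuous_on_Complex continuous_intros)
    moreover have "inj_on (\<lambda>t. Complex x t) {0<..}" by (auto simp: inj_on_def)
    ultimately show ?thesis by (intro exI[of _ "\<lambda>t. Complex x t"] exI[of _ "{0<..}"]) auto
  next
    case (CLine x r)
    then have r: "r > 0" using ok by simp
    let ?g = "\<lambda>t. of_real x + of_real r * cis t"
    have "?g ` {0<..<pi} = hset L"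
    proof (intro equalityI subsetI)
      fix z assume "z \<in> ?g ` {0<..<pi}"
      then show "z \<in> hset L" using r by (auto simp: CLine sin_gt_zero norm_mult)
    next
      fix z assume z: "z \<in> hset L"
      define w where "w = z - of_real x"
      have w: "cmod w = r" "Im w > 0" using z by (auto simp: CLine w_def)
      then have "w \<noteq> 0" by auto
      have "z = ?g (Arg w)" using w \<open>w \<noteq> 0\<close> rcis_cmod_Arg[of w] by (simp add: rcis_def w_def)
      moreover have "Arg w \<in> {0<..<pi}"
        using w Arg_bounded[of w] Arg_lt_pi[of w] by (auto simp: w)
      ultimately show "z \<in> ?g ` {0<..<pi}" by blast
    qed
    moreover have "continuous_on {0<..<pi} ?g" by (intro continuous_intros)
    moreover have "inj_on ?g {0<..<pi}"
    proof (rule inj_onI)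
      fix s t assume st: "s \<in> {0<..<pi}" "t \<in> {0<..<pi}" "?g s = ?g t"
      then have "cis s = cis t" using r by simp
      then have "cos s = cos t" by (metis cis.sel(1))
      then show "s = t" using st cos_inj_pi[of s t] by auto
    qed
    ultimately show ?thesis by (intro exI[of _ ?g] exI[of _ "{0<..<pi}"]) auto
  qed
  then obtain \<gamma> :: "real \<Rightarrow> complex" and J
    where g: "open J" "connected J" "continuous_on J \<gamma>" "inj_on \<gamma> J" "\<gamma> ` J = hset L" by blast
  then obtain t0 where "t0 \<in> J" "p = \<gamma> t0" using p by auto
  then show ?thesis
    using arc_component_at_nontrivial[OF g(1-4), of t0 R] R g(5) by simp
qed

text \<open>The Euclidean gradient of \<open>quad L\<close>, normal to the line at its
  points.\<close>

definition grad :: "hline \<Rightarrow> complex \<Rightarrow> complex" where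
  "grad L p = Complex (2 * coef_a L * Re p + coef_b L) (2 * coef_a L * Im p)"

text \<open>The second-order Taylor formula at \<open>p\<close> is exact; after division by the
  distance, the quadratic part tends to 0.\<close>

lemma quad_directional_limit:
  assumes dir: "((\<lambda>q. sgn (q - p)) \<longlongrightarrow> a) (at p within R)" and p: "quad L p = 0"
  shows "((\<lambda>q. quad L q / cmod (q - p)) \<longlongrightarrow> grad L p \<bullet> a) (at p within R)"
proof -
  have "((\<lambda>q. grad L p \<bullet> sgn (q - p) + coef_a L * cmod (q - p)) \<longlongrightarrow>
      grad L p \<bullet> a + coef_a L * cmod (p - p)) (at p within R)"
    by (intro tendsto_intros dir)
  moreover have "grad L p \<bullet> sgn (q - p) + coef_a L * cmod (q - p) = quad L q / cmod (q - p)"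
    if "q \<noteq> p" for q
  proof -
    have "quad L q = quad L p + grad L p \<bullet> (q - p) + coef_a L * (cmod (q - p))\<^sup>2"
      unfolding quad_def cmod_power2 grad_def inner_complex_def
      by (simp add: power2_eq_square algebra_simps)
    moreover have "grad L p \<bullet> sgn (q - p) = grad L p \<bullet> (q - p) / cmod (q - p)"
      by (simp add: sgn_div_norm divide_inverse mult.commute)
    ultimately show ?thesis using that p by (simp add: field_simps power2_eq_square)
  qed
  then have "\<forall>\<^sub>F q in at p within R.
      grad L p \<bullet> sgn (q - p) + coef_a L * cmod (q - p) = quad L q / cmod (q - p)"
    by (auto simp: eventually_at_filter intro!: always_eventually)
  ultimately show ?thesis
    using Lim_transform_eventually[of _ "grad L p \<bullet> a + coef_a L * cmod (p - p)"] by simp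
qed

lemma grad_pairing:
  assumes "quad L p = 0" "quad L' p = 0"
  shows "grad L p \<bullet> grad L' p = pairing L L'"
proof -
  have "grad L p \<bullet> grad L' p
      = pairing L L' + 2 * coef_a L' * quad L p + 2 * coef_a L * quad L' p"
    unfolding grad_def inner_complex_def pairing_def quad_def cmod_power2
    by (simp add: power2_eq_square algebra_simps)
  then show ?thesis using assms by simp
qed

text \<open>In the plane, \<open>g\<close> is \<open>l\<close> times \<open>a\<close> turned by a
  right angle and \<open>g'\<close> is \<open>l'\<close> times \<open>b\<close> turned likewise, so
  \<open>g \<bullet> g' = l * l' * (a \<bullet> b)\<close>. The two sign conditions multiply to
  \<open>e * e' * (l * l') * k\<^sup>2 \<le> 0\<close>.\<close>

lemma inner_normals_nonpos:
  fixes g g' a b :: complex and e e' :: real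
  assumes norm: "cmod a = 1" "cmod b = 1" and "a \<bullet> b \<ge> 0"
    and ga: "g \<bullet> a = 0" "e' * (g' \<bullet> a) \<ge> 0" and gb: "g' \<bullet> b = 0" "e * (g \<bullet> b) \<ge> 0"
    and indep: "Re g * Im g' - Im g * Re g' \<noteq> 0"
  shows "e * e' * (g \<bullet> g') \<le> 0"
proof -
  define l where "l = Re a * Im g - Im a * Re g"
  define l' where "l' = Re b * Im g' - Im b * Re g'"
  define k where "k = Re a * Im b - Im a * Re b"
  have a: "Re a * Re a + Im a * Im a = 1" and b: "Re b * Re b + Im b * Im b = 1"
    using norm cmod_power2[of a] cmod_power2[of b] by (simp_all add: power2_eq_square)
  have ga': "Re g * Re a + Im g * Im a = 0" and gb': "Re g' * Re b + Im g' * Im b = 0"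
    using ga gb by (simp_all add: inner_complex_def)
  have g: "Re g = - l * Im a" "Im g = l * Re a"
    using a ga' unfolding l_def by algebra+
  have g': "Re g' = - l' * Im b" "Im g' = l' * Re b"
    using b gb' unfolding l'_def by algebra+
  have 1: "g \<bullet> g' = l * l' * (a \<bullet> b)" "g' \<bullet> a = - l' * k" "g \<bullet> b = l * k"
    unfolding inner_complex_def g g' k_def by (simp_all add: algebra_simps)
  have "Re g * Im g' - Im g * Re g' = l * l' * k"
    unfolding g g' k_def by (simp add: algebra_simps)
  then have "k \<noteq> 0" using indep by auto
  have "(e' * (- l' * k)) * (e * (l * k)) \<ge> 0"
    using ga(2) gb(2) unfolding 1 by (rule mult_nonneg_nonneg)
  then have "(e * e' * (l * l')) * k\<^sup>2 \<le> 0" by (simp add: power2_eq_square algebra_simps)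
  then have "e * e' * (l * l') \<le> 0" using \<open>k \<noteq> 0\<close> by (simp add: mult_le_0_iff)
  then have "(e * e' * (l * l')) * (a \<bullet> b) \<le> 0"
    using \<open>a \<bullet> b \<ge> 0\<close> by (rule mult_nonpos_nonneg)
  then show ?thesis unfolding 1 by (simp add: mult.assoc)
qed

text \<open>Along the ray of \<open>L\<close> its form vanishes, so \<open>a\<close> is orthogonal
  to \<open>grad L p\<close>, while the form of \<open>L'\<close> weakly keeps the sign of
  \<open>z0\<close>, so \<open>a\<close> points inward for \<open>L'\<close>. The same holds for
  \<open>b\<close> with the lines exchanged.\<close>

lemma angle_config_pairing:
  assumes ok: "hline_ok L" "hline_ok L'" and conf: "angle_config L L' z0 m"
  shows "quad L z0 * quad L' z0 * pairing L L' \<le> 0"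
    and "quad L z0 \<noteq> 0" "quad L' z0 \<noteq> 0"
proof -
  define F where "F = frontier (connected_component_set (uhp - (hset L \<union> hset L')) z0)"
  obtain p R R' a b where m: "m \<ge> 2" and p: "hset L \<inter> hset L' = {p}"
    and R: "R \<in> components (hset L - {p})" and R': "R' \<in> components (hset L' - {p})"
    and F: "R \<subseteq> F" "R' \<subseteq> F"
    and a: "((\<lambda>q. sgn (q - p)) \<longlongrightarrow> a) (at p within R)"
    and b: "((\<lambda>q. sgn (q - p)) \<longlongrightarrow> b) (at p within R')"
    and angle: "arccos (Re (a * cnj b)) = pi / real m"
    using conf unfolding angle_config_def F_def by blast
  have pL: "p \<in> hset L" "p \<in> hset L'" using p by auto
  note nontriv = hset_component_at_nontrivial[OF ok(1) pL(1) R]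
    hset_component_at_nontrivial[OF ok(2) pL(2) R']
  have qp: "quad L p = 0" "quad L' p = 0"
    using pL quad_eq_0_iff[OF ok(1), of p] quad_eq_0_iff[OF ok(2), of p] hset_Im[OF pL(1)] by auto
  have "R \<noteq> {}" using in_components_nonempty[OF R] .
  then obtain w where "w \<in> F" using F by blast
  have sub: "uhp - (hset L \<union> hset L') \<subseteq> uhp - hset L" "uhp - (hset L \<union> hset L') \<subseteq> uhp - hset L'"
    by auto
  show nz: "quad L z0 \<noteq> 0" "quad L' z0 \<noteq> 0"
    using frontier_component_quad(1)[OF ok(1) sub(1) \<open>w \<in> F\<close>[unfolded F_def]]
      frontier_component_quad(1)[OF ok(2) sub(2) \<open>w \<in> F\<close>[unfolded F_def]] .
  have RL: "R \<subseteq> hset L" "R' \<subseteq> hset L'"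
    using in_components_subset[OF R] in_components_subset[OF R'] by auto
  have zero: "quad K q = 0" if "hline_ok K" "q \<in> hset K" for K q
    using quad_eq_0_iff[OF that(1) hset_Im[OF that(2)]] that(2) by simp
  have sgn_lim: "cmod c = 1"
    if "((\<lambda>q. sgn (q - p)) \<longlongrightarrow> c) (at p within S)" "at p within S \<noteq> bot" for c S
  proof (rule tendsto_unique[OF that(2) tendsto_norm[OF that(1)]])
    show "((\<lambda>q. cmod (sgn (q - p))) \<longlongrightarrow> 1) (at p within S)"
      by (rule tendsto_eventually)
        (auto simp: eventually_at_filter norm_sgn intro!: always_eventually)
  qed
  have norm: "cmod a = 1" "cmod b = 1" using sgn_lim a b nontriv by blast+
  have tangent: "grad K p \<bullet> c = 0"
    if "((\<lambda>q. sgn (q - p)) \<longlongrightarrow> c) (at p within S)" "at p within S \<noteq> bot" "S \<subseteq> hset K"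
      "hline_ok K" "quad K p = 0" for c S K
  proof (rule tendsto_unique[OF that(2) quad_directional_limit[OF that(1,5)]])
    show "((\<lambda>q. quad K q / cmod (q - p)) \<longlongrightarrow> 0) (at p within S)"
      using subsetD[OF that(3)] zero[OF that(4)]
      by (intro tendsto_eventually) (auto simp: eventually_at_filter intro!: always_eventually)
  qed
  have inward: "quad K z0 * (grad K p \<bullet> c) \<ge> 0"
    if "((\<lambda>q. sgn (q - p)) \<longlongrightarrow> c) (at p within S)" "at p within S \<noteq> bot" "S \<subseteq> F"
      "hline_ok K" "quad K p = 0" "uhp - (hset L \<union> hset L') \<subseteq> uhp - hset K" for c S K
  proof -
    note SF = that(3) and K = that(4,6)
    show ?thesis
    proof (rule tendsto_lowerbound[OF tendsto_mult[OF tendsto_const quad_directional_limit[OF that(1,5)]] _ that(2)])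
    have "quad K z0 * quad K q \<ge> 0" if "q \<in> S" for q
      using frontier_component_quad(2)[OF K] subsetD[OF SF that] by (simp add: F_def)
    then show "\<forall>\<^sub>F q in at p within S. 0 \<le> quad K z0 * (quad K q / cmod (q - p))"
      by (auto simp: eventually_at_filter intro!: always_eventually divide_nonneg_nonneg)
    qed
  qed
  \<comment> \<open>\<open>m \<ge> 2\<close> makes the angle at most a right angle, so its cosine is
    nonnegative; Cauchy-Schwarz keeps \<open>a \<bullet> b\<close> where \<open>cos\<close> inverts
    \<open>arccos\<close>.\<close>
  have ab: "a \<bullet> b \<ge> 0"
  proof -
    have "Re (a * cnj b) = a \<bullet> b" by (simp add: inner_complex_def)
    moreover have "cos (arccos (a \<bullet> b)) = a \<bullet> b"
      using norm_cauchy_schwarz[of a b] norm_cauchy_schwarz[of "- a" b] norm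
      by (intro cos_arccos) auto
    ultimately have "a \<bullet> b = cos (pi / real m)" using angle by simp
    moreover have "pi / real m \<ge> 0" by simp
    moreover have "pi / real m \<le> pi / 2"
      using m by (intro divide_left_mono) auto
    ultimately show ?thesis
      using pi_gt_zero cos_ge_zero[of "pi / real m"] by linarith
  qed
  \<comment> \<open>Parallel normals would make both lines vertical or give them one centre; sharing
    \<open>p\<close>, they would coincide and the ray \<open>R\<close> would be empty.\<close>
  have indep: "Re (grad L p) * Im (grad L' p) - Im (grad L p) * Re (grad L' p) \<noteq> 0"
  proof
    assume "Re (grad L p) * Im (grad L' p) - Im (grad L p) * Re (grad L' p) = 0"
    then have "2 * Im p * (coef_a L' * coef_b L - coef_a L * coef_b L') = 0"
      by (simp add: grad_def algebra_simps)
    then have "coef_a L' * coef_b L = coef_a L * coef_b L'"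
      using hset_Im[OF pL(1)] by simp
    then have "hset L = hset L'"
      using pL by (cases L; cases L') auto
    then have "hset L = {p}" using p by simp
    then have "R = {}" using in_components_subset[OF R] by simp
    then show False using \<open>R \<noteq> {}\<close> by simp
  qed
  have "quad L z0 * quad L' z0 * (grad L p \<bullet> grad L' p) \<le> 0"
  proof (rule inner_normals_nonpos[OF norm ab _ _ _ _ indep])
    show "grad L p \<bullet> a = 0" using tangent[OF a nontriv(1) RL(1) ok(1) qp(1)] .
    show "grad L' p \<bullet> b = 0" using tangent[OF b nontriv(2) RL(2) ok(2) qp(2)] .
    show "0 \<le> quad L' z0 * (grad L' p \<bullet> a)" using inward[OF a nontriv(1) F(1) ok(2) qp(2) sub(2)] .
    show "0 \<le> quad L z0 * (grad L p \<bullet> b)" using inward[OF b nontriv(2) F(2) ok(1) qp(1) sub(1)] .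
  qed
  then show "quad L z0 * quad L' z0 * pairing L L' \<le> 0"
    unfolding grad_pairing[OF qp] .
qed

lemma admissible_pair_pairing:
  assumes "hline_ok L" "hline_ok L'" "admissible_pair L L' z0"
  shows "quad L z0 * quad L' z0 * pairing L L' \<le> 0"
    and "quad L z0 \<noteq> 0" "quad L' z0 \<noteq> 0"
proof -
  have "disjoint_config L L' z0 \<or> (\<exists>m. angle_config L L' z0 m)"
    using assms(3) by (simp add: admissible_pair_def)
  then have "quad L z0 * quad L' z0 * pairing L L' \<le> 0 \<and> quad L z0 \<noteq> 0 \<and> quad L' z0 \<noteq> 0"
  proof (elim disjE exE)
    assume "disjoint_config L L' z0"
    from disjoint_config_pairing[OF assms(1,2) this] show ?thesis by simp
  next
    fix m assume "angle_config L L' z0 m"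
    from angle_config_pairing[OF assms(1,2) this] show ?thesis by simp
  qed
  then show "quad L z0 * quad L' z0 * pairing L L' \<le> 0" "quad L z0 \<noteq> 0" "quad L' z0 \<noteq> 0"
    by auto
qed

section \<open>Stationary measure of the one-way reflections\<close>

text \<open>Compactness is used on the unit circle of homogeneous coordinates: there the sum of
  gains becomes a continuous function \<open>G\<close> of degree 0, and every point is a nonzero
  multiple of the coordinates of some \<open>w\<close>.\<close>

lemma gain_lower_bound:
  fixes L :: "'i \<Rightarrow> hline"
  assumes z0: "Im z0 > 0" and "finite I"
    and near: "\<And>w. \<exists>i\<in>I. gain (L i) z0 w > 0"
  obtains e where "e > 0" "\<forall>w. (\<Sum>i\<in>I. max 0 (gain (L i) z0 w)) \<ge> e"
proof -
  define V where "V p = (fst p - snd p * Re z0)\<^sup>2 + (snd p * Im z0)\<^sup>2" for p :: "real \<times> real"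
  define Q where "Q i p = coef_a (L i) * (fst p)\<^sup>2 + coef_b (L i) * fst p * snd p
    + coef_c (L i) * (snd p)\<^sup>2" for i and p :: "real \<times> real"
  define G where "G p = (\<Sum>i\<in>I. max 0 (4 * Q i p * quad (L i) z0 / (disc (L i) * V p)))" for p
  define K where "K = sphere (0 :: real \<times> real) 1"
  have V: "V p \<noteq> 0" if "p \<in> K" for p
  proof
    assume "V p = 0"
    then have "snd p = 0" "fst p = 0"
      using z0 by (auto simp: V_def)
    then have "p = 0" by (simp add: prod_eq_iff)
    then show False using that by (simp add: K_def)
  qed
  have Ghom: "G (r * hom_u w, r * hom_v w) = (\<Sum>i\<in>I. max 0 (gain (L i) z0 w))" if "r \<noteq> 0" for r w
  proof -
    have "V (r * hom_u w, r * hom_v w) = r\<^sup>2 * visual z0 w"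
      by (simp add: V_def visual_def algebra_simps power2_eq_square)
    moreover have "Q i (r * hom_u w, r * hom_v w) = r\<^sup>2 * bquad (L i) w" for i
      by (simp add: Q_def bquad_def algebra_simps power2_eq_square)
    ultimately show ?thesis using that by (simp add: G_def gain_def mult.assoc)
  qed
  have "continuous_on K (\<lambda>p. 4 * Q i p * quad (L i) z0 / (disc (L i) * V p))" for i
  proof (cases "disc (L i) = 0")
    case False
    then show ?thesis
      using V unfolding Q_def V_def by (intro continuous_intros) auto
  qed simp
  then have cont: "continuous_on K G"
    unfolding G_def by (intro continuous_on_sum continuous_on_max continuous_on_const)
  have "K \<noteq> {}" by (simp add: K_def)
  then obtain p where p: "p \<in> K" "\<And>q. q \<in> K \<Longrightarrow> G p \<le> G q"
    using continuous_attains_inf[OF _ _ cont] by (auto simp: K_def)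
  show ?thesis
  proof (rule that)
    define w where "w = (if snd p = 0 then None else Some (fst p / snd p))"
    define r where "r = (if snd p = 0 then fst p else snd p)"
    have "r \<noteq> 0" using p(1) by (auto simp: r_def K_def norm_prod_def)
    moreover have "p = (r * hom_u w, r * hom_v w)"
      by (auto simp: r_def w_def prod_eq_iff)
    ultimately have "G p = (\<Sum>i\<in>I. max 0 (gain (L i) z0 w))" using Ghom by metis
    also have "\<dots> > 0"
    proof -
      obtain i where "i \<in> I" "gain (L i) z0 w > 0" using near by blast
      then show ?thesis using \<open>finite I\<close> by (intro sum_pos2) auto
    qed
    finally show "G p > 0" .
    show "\<forall>w. G p \<le> (\<Sum>i\<in>I. max 0 (gain (L i) z0 w))"
    proof
      fix w
      define n where "n = norm (hom_u w, hom_v w)"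
      have "n \<noteq> 0" by (cases w) (auto simp: n_def zero_prod_def)
      then have "(inverse n * hom_u w, inverse n * hom_v w) \<in> K"
        using norm_scaleR[of "inverse n" "(hom_u w, hom_v w)"] norm_ge_zero[of "(hom_u w, hom_v w)"]
        by (simp add: K_def n_def[symmetric])
      then show "G p \<le> (\<Sum>i\<in>I. max 0 (gain (L i) z0 w))"
        using Ghom[of "inverse n" w] p(2) \<open>n \<noteq> 0\<close> by fastforce
    qed
  qed
qed

lemma tau_contraction:
  fixes L :: "'i \<Rightarrow> hline"
  assumes z0: "Im z0 > 0" and I: "finite I" "I \<noteq> {}"
    and ok: "\<And>i. i \<in> I \<Longrightarrow> hline_ok (L i)"
    and near: "\<And>w. \<exists>i\<in>I. gain (L i) z0 w > 0"
  obtains c where "0 \<le> c" "c < 1"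
    "\<forall>s t. (\<Sum>i\<in>I. dist (cayley z0 (tau (L i) z0 s)) (cayley z0 (tau (L i) z0 t)))
      \<le> c * real (card I) * dist (cayley z0 s) (cayley z0 t)"
proof -
  obtain e where "e > 0" and e_le: "\<forall>w. (\<Sum>i\<in>I. max 0 (gain (L i) z0 w)) \<ge> e"
    by (rule gain_lower_bound[OF z0 I(1) near])
  note e = \<open>e > 0\<close> e_le[rule_format]
  define n where "n = real (card I)"
  have n: "n \<ge> 1" using I by (simp add: n_def Suc_leI card_gt_0_iff)
  \<comment> \<open>The square root appears because \<open>dist_tau\<close> bounds squared
    distances; \<open>e / n\<close> is the gain that the best map reaches by pigeonhole.\<close>
  define k where "k = 1 / sqrt (1 + e / n)"
  have "e / n > 0" using e n by simp
  then have k: "0 < k" "k < 1" by (simp_all add: k_def)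
  let ?d = "\<lambda>s t. dist (cayley z0 s) (cayley z0 t)"
  have dist_sqrt: "?d (tau (L i) z0 s) (tau (L i) z0 t) * sqrt (1 + max 0 (gain (L i) z0 s)) \<le> ?d s t"
    if "i \<in> I" for i s t
    by (rule power2_le_imp_le)
      (use dist_tau[OF ok[OF that] z0, of s t] in \<open>simp_all add: power_mult_distrib\<close>)
  have nonexp: "?d (tau (L i) z0 s) (tau (L i) z0 t) \<le> ?d s t" if "i \<in> I" for i s t
  proof -
    have "?d (tau (L i) z0 s) (tau (L i) z0 t) * 1
        \<le> ?d (tau (L i) z0 s) (tau (L i) z0 t) * sqrt (1 + max 0 (gain (L i) z0 s))"
      by (intro mult_left_mono) auto
    then show ?thesis using dist_sqrt[OF that, of s t] by linarith
  qed
  show ?thesis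
  proof (rule that)
    show "0 \<le> (n - 1 + k) / n" "(n - 1 + k) / n < 1" using n k by simp_all
    show "\<forall>s t. (\<Sum>i\<in>I. ?d (tau (L i) z0 s) (tau (L i) z0 t))
        \<le> (n - 1 + k) / n * real (card I) * ?d s t"
    proof (intro allI)
      fix s t
      obtain j where j: "j \<in> I" "max 0 (gain (L j) z0 s) \<ge> e / n"
      proof (rule ccontr)
        assume "\<not> thesis"
        then have "max 0 (gain (L i) z0 s) < e / n" if "i \<in> I" for i
          using \<open>\<And>j. j \<in> I \<Longrightarrow> e / n \<le> max 0 (gain (L j) z0 s) \<Longrightarrow> thesis\<close>[OF that] by linarith
        then have "(\<Sum>i\<in>I. max 0 (gain (L i) z0 s)) < (\<Sum>i\<in>I. e / n)"
          by (rule sum_strict_mono[OF I])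
        also have "\<dots> = e" using n by (simp add: n_def)
        finally show False using e(2)[of s] by simp
      qed
      have "?d (tau (L j) z0 s) (tau (L j) z0 t) * sqrt (1 + e / n)
          \<le> ?d (tau (L j) z0 s) (tau (L j) z0 t) * sqrt (1 + max 0 (gain (L j) z0 s))"
        using j(2) by (intro mult_left_mono) auto
      also have "\<dots> \<le> ?d s t" using dist_sqrt[OF j(1)] .
      finally have dj: "?d (tau (L j) z0 s) (tau (L j) z0 t) \<le> k * ?d s t"
        using k \<open>e / n > 0\<close> by (simp add: k_def pos_le_divide_eq)
      have rest: "(\<Sum>i\<in>I - {j}. ?d (tau (L i) z0 s) (tau (L i) z0 t)) \<le> (\<Sum>i\<in>I - {j}. ?d s t)"
        by (rule sum_mono) (rule nonexp, simp)
      have "(\<Sum>i\<in>I. ?d (tau (L i) z0 s) (tau (L i) z0 t))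
          = ?d (tau (L j) z0 s) (tau (L j) z0 t) + (\<Sum>i\<in>I - {j}. ?d (tau (L i) z0 s) (tau (L i) z0 t))"
        using I(1) j(1) by (rule sum.remove)
      also have "\<dots> \<le> k * ?d s t + (\<Sum>i\<in>I - {j}. ?d s t)"
        using add_mono[OF dj rest] .
      also have "(\<Sum>i\<in>I - {j}. ?d s t) = (n - 1) * ?d s t"
      proof -
        have "card I \<ge> 1" using n by (simp add: n_def)
        then show ?thesis using I(1) j(1) by (simp add: n_def of_nat_diff)
      qed
      also have "k * ?d s t + (n - 1) * ?d s t = (n - 1 + k) / n * real (card I) * ?d s t"
      proof -
        have eq: "(n - 1 + k) / n * real (card I) = n - 1 + k"
          using n by (simp add: n_def[symmetric])
        show ?thesis unfolding eq by (simp add: algebra_simps)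
      qed
      finally show "(\<Sum>i\<in>I. ?d (tau (L i) z0 s) (tau (L i) z0 t))
          \<le> (n - 1 + k) / n * real (card I) * ?d s t" .
    qed
  qed
qed

theorem mainTheorem4:
  fixes L :: "nat \<Rightarrow> hline" and z0 :: complex
  assumes "\<forall>i\<in>{1,2,3}. hline_ok (L i)"
    and "z0 \<in> uhp"
    and "\<forall>i\<in>{1,2,3}. \<forall>i'\<in>{1,2,3}. i \<noteq> i' \<longrightarrow> admissible_pair (L i) (L i') z0"
  shows "\<exists>!\<mu>. sets \<mu> = sets rbar_borel \<and> prob_space \<mu> \<and>
           (\<forall>A\<in>sets rbar_borel.
              emeasure \<mu> A =
                ennreal (1/3) * (\<Sum>i\<in>{1,2,3::nat}. emeasure (distr \<mu> rbar_borel (tau (L i) z0)) A))"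
proof -
  let ?I = "{1,2,3::nat}"
  have z0: "Im z0 > 0" using assms(2) by (simp add: uhp_def)
  have ok: "hline_ok (L i)" if "i \<in> ?I" for i using assms(1) that by blast
  have adm: "admissible_pair (L 1) (L 2) z0" "admissible_pair (L 2) (L 3) z0"
    "admissible_pair (L 1) (L 3) z0"
    using assms(3) by auto
  have ok3: "hline_ok (L 1)" "hline_ok (L 2)" "hline_ok (L 3)" using assms(1) by auto
  note p12 = admissible_pair_pairing[OF ok3(1,2) adm(1)]
    and p23 = admissible_pair_pairing[OF ok3(2,3) adm(2)]
    and p13 = admissible_pair_pairing[OF ok3(1,3) adm(3)]
  have near: "\<exists>i\<in>?I. gain (L i) z0 w > 0" for w
    using ex_near_side[OF z0 ok3 p12(2) p23(2) p23(3) p12(1) p23(1) p13(1), of w]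
      gain_pos_iff[OF ok3(1) z0] gain_pos_iff[OF ok3(2) z0] gain_pos_iff[OF ok3(3) z0] by auto
  have I: "finite ?I" "?I \<noteq> {}" by auto
  obtain c where c: "0 \<le> c" "c < 1"
    "\<forall>s t. (\<Sum>i\<in>?I. dist (cayley z0 (tau (L i) z0 s)) (cayley z0 (tau (L i) z0 t)))
      \<le> c * real (card ?I) * dist (cayley z0 s) (cayley z0 t)"
    by (rule tau_contraction[OF z0 I ok near])
  interpret average_contraction rbar_borel "cayley z0" "inv_cayley z0" "\<lambda>i. tau (L i) z0" ?I c
  proof
    show "closed (range (cayley z0))" "bounded (range (cayley z0))"
      unfolding range_cayley[OF z0] by simp_all
    show "(\<Sum>i\<in>?I. dist (cayley z0 (tau (L i) z0 s)) (cayley z0 (tau (L i) z0 t)))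
      \<le> c * real (card ?I) * dist (cayley z0 s) (cayley z0 t)" for s t
      using c(3) by blast
  qed (simp_all add: c(1,2) cayley_measurable inv_cayley_measurable inv_cayley_cayley[OF z0])
  show ?thesis using ex1_invariant unfolding invariant_def by simp
qed

end
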